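(* Let $M$ be a compact smooth manifold, $n=\dim(M)$, let $\Phi\in C^\infty(\mathbb R_{>0},\mathbb R_{>0})$, and consider on $\mathcal M(M)$ the Riemannian metric $$G_g(h,k)=\Phi(\operatorname{Vol}(g))\int_Mg^0_2(h,k)\operatorname{vol}(g).$$ Then for every $g_0\in\mathcal M(M)$ the set $\mathbb R_{>0}\,g_0$ is a totally geodesic submanifold, and the geodesic equation on $\mathbb R_{>0}\,g_0$ for paths $r(t)g_0$ is $$r''\,\Phi(\operatorname{Vol}(rg_0))=\frac{r'^2}{r}\Big(-\frac n4\,\Phi'(\operatorname{Vol}(rg_0))\operatorname{Vol}(rg_0)+\big(1-\tfrac n4\big)\Phi(\operatorname{Vol}(rg_0))\Big).$$ Moreover, if $\Phi(r)=O(r^k)$ for $r\searrow0$, for some $k>-1$, then $(\mathcal M(M),G)$ is geodesically incomplete.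
   Context: $\mathcal M(M)=\Gamma(S^2_+T^*M)$ is the space of all smooth Riemannian metrics on $M$, an open convex subset of the Fréchet space $\Gamma(S^2T^*M)$ of smooth symmetric $\binom02$-tensor fields. For symmetric $h,k$: $g^0_2(h,k)=\operatorname{Tr}(g^{-1}hg^{-1}k)$; $\operatorname{vol}(g)$ is the volume density and $\operatorname{Vol}(g)=\int_M\operatorname{vol}(g)$. With $\Phi=\Phi(\operatorname{Vol}(g))$, $\Phi'=\Phi'(\operatorname{Vol}(g))$, the geodesic equation of $G$ is $$(\Phi g_t)_t=\frac{\Phi'}4\,g\int_Mg^0_2(g_t,g_t)\operatorname{vol}(g)+\frac\Phi4\,g\,g^0_2(g_t,g_t)+\Phi\,g_tg^{-1}g_t-\frac\Phi2\,g^0_2(g_t,g)\,g_t .$$ Writing it as $g_{tt}=\Gamma_g(g_t,g_t)$ with $\Gamma_g$ symmetric bilinear, a submanifold $\mathcal N\subset\mathcal M(M)$ is totally geodesic if $\Gamma_g(h,k)\in T_g\mathcal N$ for all $g\in\mathcal N$, $h,k\in T_g\mathcal N$. Geodesically incomplete means that some geodesic cannot be extended to all times. *)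

theory Defs
  imports "HOL-Analysis.Analysis" "HOL-Library.Landau_Symbols"
begin

section \<open>Smooth maps between normed spaces\<close>

text \<open>\<^term>\<open>S\<close> is meant to be open. \<open>C_on k S f\<close> says that \<open>f\<close> is of class \<open>C\<^sup>k\<close> on \<open>S\<close>; on finite-dimensional
  spaces it suffices to iterate directional derivatives.\<close>

primrec C_on ::
  "nat \<Rightarrow> 'a::real_normed_vector set \<Rightarrow> ('a \<Rightarrow> 'b::real_normed_vector) \<Rightarrow> bool" where
  "C_on 0 S f \<longleftrightarrow> continuous_on S f"
| "C_on (Suc k) S f \<longleftrightarrow>
     (\<forall>x\<in>S. f differentiable (at x)) \<and> (\<forall>v. C_on k S (\<lambda>x. frechet_derivative f (at x) v))"

definition smooth_on ::
  "'a::real_normed_vector set \<Rightarrow> ('a \<Rightarrow> 'b::real_normed_vector) \<Rightarrow> bool" where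
  "smooth_on S f \<longleftrightarrow> (\<forall>k. C_on k S f)"

section \<open>Compact smooth manifolds\<close>

text \<open>A chart is a pair of its domain and its coordinate map. The dimension \<open>n\<close> is \<open>CARD('n)\<close>,
  so \<open>n \<ge> 1\<close>; all charts are onto open subsets of \<open>\<real>\<^sup>n\<close>, so there is no boundary.\<close>

type_synonym ('a, 'n) chart = "'a set \<times> ('a \<Rightarrow> real ^ 'n)"

definition chart_image :: "('a, 'n) chart \<Rightarrow> (real ^ 'n) set" where
  "chart_image c = snd c ` fst c"

definition chart_inv :: "('a, 'n) chart \<Rightarrow> real ^ 'n \<Rightarrow> 'a" where
  "chart_inv c = inv_into (fst c) (snd c)"

definition is_chart :: "'a topology \<Rightarrow> ('a, 'n::finite) chart \<Rightarrow> bool" where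
  "is_chart X c \<longleftrightarrow> openin X (fst c) \<and> open (chart_image c) \<and>
     homeomorphic_map (subtopology X (fst c)) (top_of_set (chart_image c)) (snd c)"

definition transition :: "('a, 'n) chart \<Rightarrow> ('a, 'n) chart \<Rightarrow> real ^ 'n \<Rightarrow> real ^ 'n" where
  "transition c d = snd d \<circ> chart_inv c"

definition smooth_atlas :: "'a topology \<Rightarrow> ('a, 'n::finite) chart set \<Rightarrow> bool" where
  "smooth_atlas X A \<longleftrightarrow> (\<forall>c\<in>A. is_chart X c) \<and> (\<Union>c\<in>A. fst c) = topspace X \<and>
     (\<forall>c\<in>A. \<forall>d\<in>A. smooth_on (snd c ` (fst c \<inter> fst d)) (transition c d))"

definition compact_smooth_manifold :: "'a topology \<Rightarrow> ('a, 'n::finite) chart set \<Rightarrow> bool" where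
  "compact_smooth_manifold X A \<longleftrightarrow>
     Hausdorff_space X \<and> second_countable X \<and> compact_space X \<and> smooth_atlas X A"

definition jacobian ::
  "('a, 'n::finite) chart \<Rightarrow> ('a, 'n) chart \<Rightarrow> 'a \<Rightarrow> real ^ 'n ^ 'n" where
  "jacobian c d p = matrix (frechet_derivative (transition c d) (at (snd c p)))"

section \<open>Symmetric tensor fields and Riemannian metrics\<close>

text \<open>A field of type (0,2) is given by its component matrices: \<open>h c p\<close> is the matrix of \<open>h\<close> at
  \<open>p\<close> in the chart \<open>c\<close>. It is set to 0 outside the atlas and outside the chart domain, so that
  equality of tensor fields is equality of functions and operations are pointwise.\<close>

type_synonym ('a, 'n) tensor2 = "('a, 'n) chart \<Rightarrow> 'a \<Rightarrow> real ^ 'n ^ 'n"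

text \<open>The space \<open>\<Gamma>(S\<^sup>2T\<^sup>*M)\<close>.\<close>

definition sym_tensors ::
  "'a topology \<Rightarrow> ('a, 'n::finite) chart set \<Rightarrow> ('a, 'n) tensor2 set" where
  "sym_tensors X A = {h.
     (\<forall>c p. c \<notin> A \<or> p \<notin> fst c \<longrightarrow> h c p = 0) \<and>
     (\<forall>c\<in>A. \<forall>p\<in>fst c. transpose (h c p) = h c p) \<and>
     (\<forall>c\<in>A. \<forall>d\<in>A. \<forall>p\<in>fst c \<inter> fst d.
        h c p = transpose (jacobian c d p) ** h d p ** jacobian c d p) \<and>
     (\<forall>c\<in>A. smooth_on (chart_image c) (\<lambda>x. h c (chart_inv c x)))}"

text \<open>The space \<open>\<M>(M)\<close>.\<close>

definition metrics ::
  "'a topology \<Rightarrow> ('a, 'n::finite) chart set \<Rightarrow> ('a, 'n) tensor2 set" where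
  "metrics X A = {g \<in> sym_tensors X A.
     \<forall>c\<in>A. \<forall>p\<in>fst c. \<forall>v. v \<noteq> 0 \<longrightarrow> 0 < v \<bullet> (g c p *v v)}"

definition tscale :: "real \<Rightarrow> ('a, 'n::finite) tensor2 \<Rightarrow> ('a, 'n) tensor2" where
  "tscale a h = (\<lambda>c p. a *\<^sub>R h c p)"

definition tplus :: "('a, 'n::finite) tensor2 \<Rightarrow> ('a, 'n) tensor2 \<Rightarrow> ('a, 'n) tensor2" where
  "tplus h k = (\<lambda>c p. h c p + k c p)"

section \<open>Volume, integration and the metric \<open>G\<close>\<close>

text \<open>\<open>Tr(g\<inverse> h g\<inverse> k)\<close>, computed in a chart. Like every scalar function below it is indexed by
  charts, although for tensor fields its value at a point does not depend on the chart.\<close>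

definition g02 :: "('a, 'n::finite) tensor2 \<Rightarrow> ('a, 'n) tensor2 \<Rightarrow> ('a, 'n) tensor2 \<Rightarrow>
    ('a, 'n) chart \<Rightarrow> 'a \<Rightarrow> real" where
  "g02 g h k c p = trace (matrix_inv (g c p) ** h c p ** matrix_inv (g c p) ** k c p)"

text \<open>A finite partition of unity subordinate to the atlas. Continuity is enough to integrate
  densities.\<close>

definition partition_of_unity ::
  "'a topology \<Rightarrow> ('a, 'n) chart set \<Rightarrow> ('a, 'n) chart set \<Rightarrow> (('a, 'n) chart \<Rightarrow> 'a \<Rightarrow> real) \<Rightarrow> bool"
where
  "partition_of_unity X A F \<rho> \<longleftrightarrow> finite F \<and> F \<subseteq> A \<and>
     (\<forall>c\<in>F. continuous_map X euclideanreal (\<rho> c) \<and> (\<forall>p\<in>topspace X. 0 \<le> \<rho> c p) \<and>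
        X closure_of {p \<in> topspace X. \<rho> c p \<noteq> 0} \<subseteq> fst c) \<and>
     (\<forall>p\<in>topspace X. (\<Sum>c\<in>F. \<rho> c p) = 1)"

text \<open>\<open>\<integral>\<^sub>M f vol(g)\<close>, where \<open>vol(g)\<close> is \<open>sqrt(det g)\<close> times Lebesgue measure in a chart. As usual
  the value does not depend on the partition of unity, so any one may be chosen.\<close>

definition vol_integral :: "'a topology \<Rightarrow> ('a, 'n::finite) chart set \<Rightarrow> ('a, 'n) tensor2 \<Rightarrow>
    (('a, 'n) chart \<Rightarrow> 'a \<Rightarrow> real) \<Rightarrow> real" where
  "vol_integral X A g f =
     (let P = (SOME P. partition_of_unity X A (fst P) (snd P)) in
      \<Sum>c\<in>fst P. LINT x:chart_image c|lborel.
        snd P c (chart_inv c x) * f c (chart_inv c x) * sqrt (det (g c (chart_inv c x))))"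

definition Vol :: "'a topology \<Rightarrow> ('a, 'n::finite) chart set \<Rightarrow> ('a, 'n) tensor2 \<Rightarrow> real" where
  "Vol X A g = vol_integral X A g (\<lambda>c p. 1)"

text \<open>The Riemannian metric \<open>G\<close> on \<open>\<M>(M)\<close>; \<open>geodesic_on\<close> below is its geodesic equation.\<close>

definition G_metric :: "'a topology \<Rightarrow> ('a, 'n::finite) chart set \<Rightarrow> (real \<Rightarrow> real) \<Rightarrow>
    ('a, 'n) tensor2 \<Rightarrow> ('a, 'n) tensor2 \<Rightarrow> ('a, 'n) tensor2 \<Rightarrow> real" where
  "G_metric X A \<Phi> g h k = \<Phi> (Vol X A g) * vol_integral X A g (g02 g h k)"

section \<open>Smooth paths and submanifolds\<close>

text \<open>A path \<open>I \<rightarrow> \<Gamma>(S\<^sup>2T\<^sup>*M)\<close> (\<open>I\<close> open) is smooth into the Frechet space iff its components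
  depend smoothly on time and space jointly.\<close>

definition smooth_path_on :: "'a topology \<Rightarrow> ('a, 'n::finite) chart set \<Rightarrow> real set \<Rightarrow>
    (real \<Rightarrow> ('a, 'n) tensor2) \<Rightarrow> bool" where
  "smooth_path_on X A I \<gamma> \<longleftrightarrow> (\<forall>t\<in>I. \<gamma> t \<in> sym_tensors X A) \<and>
     (\<forall>c\<in>A. smooth_on (I \<times> chart_image c) (\<lambda>(t, x). \<gamma> t c (chart_inv c x)))"

definition velocity :: "(real \<Rightarrow> ('a, 'n::finite) tensor2) \<Rightarrow> real \<Rightarrow> ('a, 'n) tensor2" where
  "velocity \<gamma> t = (\<lambda>c p. vector_derivative (\<lambda>s. \<gamma> s c p) (at t))"

text \<open>Submanifolds are understood as in the convenient calculus of Kriegl and Michor. The topology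
  is the final one with respect to all smooth curves, which on a Frechet space is the given
  topology, and a map is smooth iff it sends smooth curves to smooth curves.\<close>

definition open_tensors ::
  "'a topology \<Rightarrow> ('a, 'n::finite) chart set \<Rightarrow> ('a, 'n) tensor2 set \<Rightarrow> bool" where
  "open_tensors X A U \<longleftrightarrow> U \<subseteq> sym_tensors X A \<and>
     (\<forall>\<gamma>. smooth_path_on X A UNIV \<gamma> \<longrightarrow> open {t. \<gamma> t \<in> U})"

definition smooth_map :: "'a topology \<Rightarrow> ('a, 'n::finite) chart set \<Rightarrow>
    ('a, 'n) tensor2 set \<Rightarrow> (('a, 'n) tensor2 \<Rightarrow> ('a, 'n) tensor2) \<Rightarrow> bool" where
  "smooth_map X A U f \<longleftrightarrow>
     (\<forall>\<gamma>. smooth_path_on X A UNIV \<gamma> \<and> (\<forall>t. \<gamma> t \<in> U) \<longrightarrow> smooth_path_on X A UNIV (\<lambda>t. f (\<gamma> t)))"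

definition closed_subspace ::
  "'a topology \<Rightarrow> ('a, 'n::finite) chart set \<Rightarrow> ('a, 'n) tensor2 set \<Rightarrow> bool" where
  "closed_subspace X A F \<longleftrightarrow> F \<subseteq> sym_tensors X A \<and> open_tensors X A (sym_tensors X A - F) \<and>
     (\<lambda>c p. 0) \<in> F \<and> (\<forall>h\<in>F. \<forall>k\<in>F. tplus h k \<in> F) \<and> (\<forall>a. \<forall>h\<in>F. tscale a h \<in> F)"

definition submanifold ::
  "'a topology \<Rightarrow> ('a, 'n::finite) chart set \<Rightarrow> ('a, 'n) tensor2 set \<Rightarrow> bool" where
  "submanifold X A N \<longleftrightarrow> N \<subseteq> metrics X A \<and>
     (\<forall>g\<in>N. \<exists>U V u F. g \<in> U \<and> U \<subseteq> metrics X A \<and> open_tensors X A U \<and> open_tensors X A V \<and>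
        bij_betw u U V \<and> smooth_map X A U u \<and> smooth_map X A V (inv_into U u) \<and>
        closed_subspace X A F \<and> u ` (U \<inter> N) = V \<inter> F)"

text \<open>\<open>T\<^sub>gN\<close>: the velocities of smooth curves in \<open>N\<close> through \<open>g\<close>.\<close>

definition tangent_space :: "'a topology \<Rightarrow> ('a, 'n::finite) chart set \<Rightarrow> ('a, 'n) tensor2 set \<Rightarrow>
    ('a, 'n) tensor2 \<Rightarrow> ('a, 'n) tensor2 set" where
  "tangent_space X A N g =
     {velocity \<gamma> 0 | \<gamma>. smooth_path_on X A UNIV \<gamma> \<and> (\<forall>t. \<gamma> t \<in> N) \<and> \<gamma> 0 = g}"

section \<open>Geodesics of \<open>G\<close>\<close>

text \<open>Solutions on the open interval \<open>I\<close> of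
  \<open>(\<Phi> g\<^sub>t)\<^sub>t = \<Phi>'/4 g \<integral> g02(g\<^sub>t,g\<^sub>t) vol(g) + \<Phi>/4 g g02(g\<^sub>t,g\<^sub>t) + \<Phi> g\<^sub>t g\<inverse> g\<^sub>t - \<Phi>/2 g02(g\<^sub>t,g) g\<^sub>t\<close>,
  where \<open>\<Phi>\<close> and \<open>\<Phi>'\<close> are evaluated at \<open>Vol(g)\<close>.\<close>

definition geodesic_on :: "'a topology \<Rightarrow> ('a, 'n::finite) chart set \<Rightarrow> (real \<Rightarrow> real) \<Rightarrow> real set \<Rightarrow>
    (real \<Rightarrow> ('a, 'n) tensor2) \<Rightarrow> bool" where
  "geodesic_on X A \<Phi> I \<gamma> \<longleftrightarrow>
     smooth_path_on X A I \<gamma> \<and> (\<forall>t\<in>I. \<gamma> t \<in> metrics X A) \<and>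
     (\<forall>t\<in>I. let g = \<gamma> t; gt = velocity \<gamma> t; v = Vol X A g in
        \<forall>c\<in>A. \<forall>p\<in>fst c.
          ((\<lambda>s. \<Phi> (Vol X A (\<gamma> s)) *\<^sub>R velocity \<gamma> s c p) has_vector_derivative
             (deriv \<Phi> v / 4 * vol_integral X A g (g02 g gt gt)) *\<^sub>R g c p
           + (\<Phi> v / 4 * g02 g gt gt c p) *\<^sub>R g c p
           + \<Phi> v *\<^sub>R (gt c p ** matrix_inv (g c p) ** gt c p)
           - (\<Phi> v / 2 * g02 g gt g c p) *\<^sub>R gt c p) (at t))"

text \<open>The symmetric bilinear \<open>\<Gamma>\<^sub>g\<close> for which that equation reads \<open>g\<^sub>t\<^sub>t = \<Gamma>\<^sub>g(g\<^sub>t,g\<^sub>t)\<close>. The last summand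
  comes from the derivative of \<open>\<Phi>(Vol(g))\<close> on the left-hand side, where
  \<open>Vol(g)\<^sub>t = 1/2 \<integral> Tr(g\<inverse> g\<^sub>t) vol(g)\<close> and \<open>Tr(g\<inverse> g\<^sub>t) = g02(g\<^sub>t,g)\<close>.\<close>

definition Christoffel :: "'a topology \<Rightarrow> ('a, 'n::finite) chart set \<Rightarrow> (real \<Rightarrow> real) \<Rightarrow>
    ('a, 'n) tensor2 \<Rightarrow> ('a, 'n) tensor2 \<Rightarrow> ('a, 'n) tensor2 \<Rightarrow> ('a, 'n) tensor2" where
  "Christoffel X A \<Phi> g h k = (\<lambda>c p. let v = Vol X A g; q = deriv \<Phi> v / \<Phi> v in
       (q / 4 * vol_integral X A g (g02 g h k)) *\<^sub>R g c p
     + (g02 g h k c p / 4) *\<^sub>R g c p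
     + (1 / 2) *\<^sub>R (h c p ** matrix_inv (g c p) ** k c p + k c p ** matrix_inv (g c p) ** h c p)
     - (1 / 4) *\<^sub>R (g02 g h g c p *\<^sub>R k c p + g02 g k g c p *\<^sub>R h c p)
     - (q / 4) *\<^sub>R (vol_integral X A g (g02 g h g) *\<^sub>R k c p
                   + vol_integral X A g (g02 g k g) *\<^sub>R h c p))"

definition totally_geodesic :: "'a topology \<Rightarrow> ('a, 'n::finite) chart set \<Rightarrow> (real \<Rightarrow> real) \<Rightarrow>
    ('a, 'n) tensor2 set \<Rightarrow> bool" where
  "totally_geodesic X A \<Phi> N \<longleftrightarrow>
     (\<forall>g\<in>N. \<forall>h\<in>tangent_space X A N g. \<forall>k\<in>tangent_space X A N g.
        Christoffel X A \<Phi> g h k \<in> tangent_space X A N g)"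

definition open_interval :: "real set \<Rightarrow> bool" where
  "open_interval I \<longleftrightarrow> I \<noteq> {} \<and> open I \<and> is_interval I"

definition geodesically_incomplete ::
  "'a topology \<Rightarrow> ('a, 'n::finite) chart set \<Rightarrow> (real \<Rightarrow> real) \<Rightarrow> bool" where
  "geodesically_incomplete X A \<Phi> \<longleftrightarrow>
     (\<exists>I \<gamma>. open_interval I \<and> geodesic_on X A \<Phi> I \<gamma> \<and>
        \<not> (\<exists>\<delta>. geodesic_on X A \<Phi> UNIV \<delta> \<and> (\<forall>t\<in>I. \<delta> t = \<gamma> t)))"

definition ray :: "('a, 'n::finite) tensor2 \<Rightarrow> ('a, 'n) tensor2 set" where
  "ray g\<^sub>0 = {tscale r g\<^sub>0 | r. 0 < r}"

end

theory Submission
  imports Defs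
begin

text \<open>
  A ray \<open>\<real>\<^sub>>\<^sub>0 g\<close> is the intersection of the line \<open>\<real> g\<close> with the open set of all metrics, so it is
  a submanifold, and the identity serves as its submanifold chart. Its tangent spaces are all equal to the line.
  If \<open>h\<close> and \<open>k\<close> are multiples of \<open>g\<close>, then \<open>g\<^sup>-\<^sup>1h\<close> and \<open>g\<^sup>-\<^sup>1k\<close> are multiples of the identity matrix, the function \<open>g02\<close> is constant,
  and every summand of the Christoffel symbol is a multiple of \<open>g\<close>: the ray is totally geodesic.
  The same computation together with \<open>Vol(r g) = r\<^bsup>n/2\<^esup> Vol(g)\<close> turns both sides of the
  geodesic equation for \<open>r(t) g\<close> into multiples of \<open>g\<close>, and comparing the coefficients gives the
  ordinary differential equation (\<open>geodesic_ray_iff\<close>).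

  For the incompleteness, that equation says that \<open>r' \<surd>(\<Phi>(Vol(r g)) r\<^bsup>n/2-2\<^esup>)\<close>, up to a factor the \<open>G\<close>-speed, is constant.
  In the variable \<open>x = ln r\<close> this is the first-order equation \<open>x' = 1 / F(x)\<close> with
  \<open>F(x)\<^sup>2 = \<Phi>(Vol(g) e\<^bsup>nx/2\<^esup>) e\<^bsup>nx/2\<^esup>\<close>, which is solved by inverting a primitive \<open>H\<close> of \<open>F\<close>. The bound
  \<open>\<Phi>(s) = O(s\<^bsup>k\<^esup>)\<close> gives \<open>F(x) = O(e\<^bsup>\<beta>x\<^esup>)\<close> as \<open>x\<close> tends to \<open>-\<infinity>\<close>, with \<open>\<beta> = (k+1)n/4 > 0\<close>. So \<open>F\<close> is
  integrable at \<open>-\<infinity>\<close>, \<open>H\<close> is bounded below, and \<open>r\<close> tends to 0 at the finite time \<open>a = Inf (range H)\<close>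
  (\<open>ode_escape\<close>). A geodesic defined for all times that extends \<open>r(t) g\<close> would, by continuity in
  \<open>t\<close>, have the value 0 at time \<open>a\<close>, which is not a metric.

  Two facts of differential topology are behind this. The volume is positive, for which continuous
  partitions of unity must exist (\<open>partition_of_unity_exists\<close>); its integrand is continuous
  with compact support in each chart, so it is integrable. And some Riemannian metric must exist for a geodesic
  to start from (\<open>metric_exists\<close>). Both are obtained from one finite family of smooth bump functions
  supported in charts (\<open>finite_bumps\<close>).
\<close>

section \<open>Calculus of iterated directional derivatives\<close>

text \<open>On an open set the derivative sees only the values on the set, so \<open>C_on\<close> does not
  depend on values elsewhere.\<close>

lemma C_on_cong:
  assumes "open S" and "\<And>x. x \<in> S \<Longrightarrow> f x = g x" and "C_on k S f"
  shows "C_on k S g"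
  using assms(2,3)
proof (induction k arbitrary: f g)
  case 0
  then show ?case by (metis C_on.simps(1) continuous_on_cong)
next
  case (Suc k)
  have g: "(g has_derivative frechet_derivative f (at x)) (at x)" if "x \<in> S" for x
  proof -
    have "(f has_derivative frechet_derivative f (at x)) (at x)"
      using Suc.prems(2) that by (simp add: frechet_derivative_works)
    then show ?thesis
      using has_derivative_transform_within_open[OF _ assms(1) that] Suc.prems(1) by blast
  qed
  have "C_on k S (\<lambda>x. frechet_derivative g (at x) v)" for v
    by (rule Suc.IH[of "\<lambda>x. frechet_derivative f (at x) v"])
       (use Suc.prems(2) frechet_derivative_at[OF g] in auto)
  then show ?case
    using g by (auto simp: differentiable_def)
qed

lemma C_on_SucI:
  assumes "open S" and f: "\<And>x. x \<in> S \<Longrightarrow> (f has_derivative f' x) (at x)"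
    and "\<And>v. C_on k S (\<lambda>x. f' x v)"
  shows "C_on (Suc k) S f"
proof -
  have "C_on k S (\<lambda>x. frechet_derivative f (at x) v)" for v
    by (rule C_on_cong[OF assms(1) _ assms(3)[of v]]) (use frechet_derivative_at[OF f] in auto)
  then show ?thesis
    using f by (auto simp: differentiable_def)
qed

lemma C_on_SucD:
  assumes "C_on (Suc k) S f"
  shows "x \<in> S \<Longrightarrow> (f has_derivative frechet_derivative f (at x)) (at x)"
    and "C_on k S (\<lambda>x. frechet_derivative f (at x) v)"
  using assms by (auto simp: frechet_derivative_works)

lemma C_on_subset: "C_on k S f \<Longrightarrow> T \<subseteq> S \<Longrightarrow> C_on k T f"
  by (induction k arbitrary: f) (auto intro: continuous_on_subset)

lemma C_on_local:
  assumes "\<And>x. x \<in> S \<Longrightarrow> \<exists>T. open T \<and> x \<in> T \<and> C_on k T f"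
  shows "C_on k S f"
  using assms
proof (induction k arbitrary: f)
  case 0
  have "isCont f x" if x: "x \<in> S" for x
  proof -
    obtain T where "open T" "x \<in> T" "continuous_on T f"
      using 0[OF x] by auto
    then show ?thesis by (simp add: continuous_on_eq_continuous_at)
  qed
  then show ?case by (simp add: continuous_at_imp_continuous_on)
next
  case (Suc k)
  have "C_on k S (\<lambda>x. frechet_derivative f (at x) v)" for v
    using Suc.prems by (intro Suc.IH) fastforce
  moreover have "f differentiable (at x)" if "x \<in> S" for x
    using Suc.prems[OF that] by auto
  ultimately show ?case by simp
qed

lemma C_on_lower: "C_on (Suc k) S f \<Longrightarrow> C_on k S f"
proof (induction k arbitrary: f)
  case 0
  then show ?case
    by (auto intro!: continuous_at_imp_continuous_on differentiable_imp_continuous_within)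
next
  case (Suc k)
  then show ?case by (metis C_on.simps(2))
qed

lemma C_on_const: "C_on k S (\<lambda>x. c)"
proof (induction k arbitrary: c)
  case (Suc k)
  then show ?case
    by (auto simp: frechet_derivative_const)
qed simp

lemma C_on_linear:
  assumes "open S" and "bounded_linear L"
  shows "C_on k S L"
proof (cases k)
  case 0
  then show ?thesis
    using assms(2) by (auto intro: linear_continuous_on)
next
  case (Suc m)
  show ?thesis unfolding Suc
    by (rule C_on_SucI[OF assms(1) bounded_linear_imp_has_derivative[OF assms(2)]])
       (rule C_on_const)
qed

lemma C_on_add:
  assumes "open S"
  shows "C_on k S f \<Longrightarrow> C_on k S g \<Longrightarrow> C_on k S (\<lambda>x. f x + g x)"
proof (induction k arbitrary: f g)
  case 0
  then show ?case by (auto intro: continuous_intros)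
next
  case (Suc k)
  note D = C_on_SucD[OF Suc.prems(1)] C_on_SucD[OF Suc.prems(2)]
  show ?case
    by (rule C_on_SucI[OF assms has_derivative_add[OF D(1) D(3)]]) (auto intro: Suc.IH D(2,4))
qed

lemma C_on_sum:
  assumes "open S" and "\<And>i. i \<in> I \<Longrightarrow> C_on k S (f i)"
  shows "C_on k S (\<lambda>x. \<Sum>i\<in>I. f i x)"
  using assms(2)
  by (induction I rule: infinite_finite_induct) (auto intro!: C_on_const C_on_add[OF assms(1)])

lemma C_on_bilinear:
  assumes "open S" and B: "bounded_bilinear B"
  shows "C_on k S f \<Longrightarrow> C_on k S g \<Longrightarrow> C_on k S (\<lambda>x. B (f x) (g x))"
proof (induction k arbitrary: f g)
  case 0
  then show ?case using bounded_bilinear.continuous_on[OF B] by auto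
next
  case (Suc k)
  have lower: "C_on k S f" "C_on k S g"
    using Suc.prems C_on_lower by blast+
  note D = C_on_SucD[OF Suc.prems(1)] C_on_SucD[OF Suc.prems(2)]
  show ?case
  proof (rule C_on_SucI[OF assms(1) bounded_bilinear.FDERIV[OF B D(1) D(3)]])
    show "C_on k S (\<lambda>x. B (f x) (frechet_derivative g (at x) v) + B (frechet_derivative f (at x) v) (g x))"
      for v
      by (intro C_on_add[OF assms(1)] Suc.IH lower D(2,4))
  qed
qed

text \<open>The derivative of \<open>g \<circ> f\<close> in a direction \<open>v\<close> applies \<open>Dg(f
  x)\<close> to the varying vector \<open>Df(x) v\<close>, whereas \<open>C_on\<close> only speaks of fixed
  directions. Expanding \<open>Df(x) v\<close> in a basis reduces it to these, which is why the intermediate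
  space is Euclidean.\<close>

lemma C_on_compose:
  fixes f :: "'a::real_normed_vector \<Rightarrow> 'b::euclidean_space"
  assumes "open S" and "f ` S \<subseteq> T" and "open T"
  shows "C_on k S f \<Longrightarrow> C_on k T g \<Longrightarrow> C_on k S (\<lambda>x. g (f x))"
  using assms(2)
proof (induction k arbitrary: g)
  case 0
  then show ?case using continuous_on_compose2 by auto
next
  case (Suc k)
  let ?f' = "\<lambda>x. frechet_derivative f (at x)" and ?g' = "\<lambda>y. frechet_derivative g (at y)"
  have f': "(f has_derivative ?f' x) (at x)" if "x \<in> S" for x
    using C_on_SucD(1)[OF Suc.prems(1) that] .
  have g': "(g has_derivative ?g' (f x)) (at (f x))" if "x \<in> S" for x
    using C_on_SucD(1)[OF Suc.prems(2)] that Suc.prems(3) by auto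
  have expand: "?g' (f x) (?f' x v) = (\<Sum>b\<in>Basis. (?f' x v \<bullet> b) *\<^sub>R ?g' (f x) b)" if "x \<in> S" for x v
  proof -
    have "linear (?g' (f x))" using g'[OF that] has_derivative_linear by blast
    then have "(\<Sum>b\<in>Basis. (?f' x v \<bullet> b) *\<^sub>R ?g' (f x) b) = ?g' (f x) (\<Sum>b\<in>Basis. (?f' x v \<bullet> b) *\<^sub>R b)"
      by (simp add: linear_sum linear_scale)
    then show ?thesis by (simp add: euclidean_representation)
  qed
  have "C_on k S (\<lambda>x. \<Sum>b\<in>Basis. (?f' x v \<bullet> b) *\<^sub>R ?g' (f x) b)" for v
  proof (intro C_on_sum C_on_bilinear[OF \<open>open S\<close> bounded_bilinear_scaleR] assms(1))
    fix b :: 'b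
    show "C_on k S (\<lambda>x. ?f' x v \<bullet> b)"
      by (rule C_on_bilinear[OF \<open>open S\<close> bounded_bilinear_inner _ C_on_const])
         (rule C_on_SucD(2)[OF Suc.prems(1)])
    show "C_on k S (\<lambda>x. ?g' (f x) b)"
      using Suc.IH[OF C_on_lower[OF Suc.prems(1)] C_on_SucD(2)[OF Suc.prems(2)] Suc.prems(3)] .
  qed
  then have "C_on k S (\<lambda>x. ?g' (f x) (?f' x v))" for v
    by (rule C_on_cong[OF \<open>open S\<close>, rotated]) (simp add: expand)
  moreover have "((\<lambda>x. g (f x)) has_derivative (\<lambda>v. ?g' (f x) (?f' x v))) (at x)" if "x \<in> S" for x
    using has_derivative_compose[OF f'[OF that] g'[OF that]] .
  ultimately show ?case
    by (intro C_on_SucI[OF \<open>open S\<close>, where f' = "\<lambda>x v. ?g' (f x) (?f' x v)"])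
qed

lemma C_on_realI:
  fixes f :: "real \<Rightarrow> real"
  assumes "open S" and "\<And>x. x \<in> S \<Longrightarrow> (f has_real_derivative f' x) (at x)" and "C_on k S f'"
  shows "C_on (Suc k) S f"
proof (rule C_on_SucI[OF assms(1)])
  show "(f has_derivative (\<lambda>v. f' x * v)) (at x)" if "x \<in> S" for x
    using assms(2)[OF that] by (simp add: has_field_derivative_def)
  show "C_on k S (\<lambda>x. f' x * v)" for v
    by (rule C_on_bilinear[OF assms(1) bounded_bilinear_mult assms(3) C_on_const])
qed

lemma C_on_realD:
  fixes f :: "real \<Rightarrow> real"
  assumes "open S" and "C_on (Suc k) S f"
  shows "x \<in> S \<Longrightarrow> (f has_real_derivative deriv f x) (at x)" and "C_on k S (deriv f)"
proof -
  show *: "(f has_real_derivative deriv f x) (at x)" if "x \<in> S" for x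
    using assms(2) that by (auto simp: field_differentiable_derivI real_differentiable_def
        DERIV_deriv_iff_real_differentiable)
  have "frechet_derivative f (at x) 1 = deriv f x" if "x \<in> S" for x
    using frechet_derivative_at[OF *[OF that, unfolded has_field_derivative_def], symmetric] by simp
  then show "C_on k S (deriv f)"
    using C_on_cong[OF assms(1) _ C_on_SucD(2)[OF assms(2), of 1]] by blast
qed

lemma C_on_exp: "C_on k UNIV (exp :: real \<Rightarrow> real)"
proof (induction k)
  case (Suc k)
  then show ?case by (intro C_on_realI[of _ _ exp]) (auto intro: DERIV_exp)
qed (auto intro: continuous_intros)

lemma C_on_inverse: "C_on k {0<..} (inverse :: real \<Rightarrow> real)"
proof (induction k)
  case (Suc k)
  have "C_on k {0<..} (\<lambda>x::real. (- 1) * (inverse x * inverse x))"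
    by (intro C_on_bilinear[OF _ bounded_bilinear_mult] C_on_const Suc) auto
  then show ?case
    by (rule C_on_realI[rotated 2]) (auto intro!: derivative_eq_intros simp: field_simps)
qed (auto intro: continuous_intros)

lemma C_on_ln: "C_on k {0<..} (ln :: real \<Rightarrow> real)"
proof (cases k)
  case (Suc m)
  show ?thesis unfolding Suc
    by (rule C_on_realI[of _ _ inverse])
       (auto intro: C_on_inverse derivative_eq_intros simp: field_simps)
qed (auto intro: continuous_intros)

section \<open>A flat function\<close>

text \<open>The parameter \<open>m\<close> makes the family closed under differentiation, so that all
  derivatives of \<open>exp (- 1 / s)\<close>, extended by 0, can be treated by one induction.\<close>

definition flat :: "nat \<Rightarrow> real \<Rightarrow> real" where
  "flat m s = (if 0 < s then inverse s ^ m * exp (- inverse s) else 0)"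

lemma flat_nonneg: "0 \<le> flat m s"
  by (simp add: flat_def)

lemma flat_pos_iff: "0 < flat m s \<longleftrightarrow> 0 < s"
  by (simp add: flat_def)

lemma flat_tendsto_0: "(flat m \<longlongrightarrow> 0) (at 0)"
proof -
  have "((\<lambda>x::real. x ^ m / exp x) \<longlongrightarrow> 0) at_top"
    by (rule tendsto_power_div_exp_0)
  then have "((\<lambda>s::real. inverse s ^ m / exp (inverse s)) \<longlongrightarrow> 0) (at_right 0)"
    by (rule filterlim_compose[OF _ filterlim_inverse_at_top_right])
  then have "(flat m \<longlongrightarrow> 0) (at_right 0)"
    by (rule Lim_transform_eventually)
       (auto simp: eventually_at_filter flat_def exp_minus field_simps)
  moreover have "(flat m \<longlongrightarrow> 0) (at_left 0)"
    by (rule Lim_transform_eventually[OF tendsto_const])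
       (auto simp: eventually_at_filter flat_def)
  ultimately show ?thesis
    by (simp add: filterlim_at_split)
qed

text \<open>At 0 the difference quotient of \<open>flat m\<close> is \<open>flat (m + 1)\<close>, which tends
  to 0.\<close>

lemma flat_deriv: "(flat m has_real_derivative - real m * flat (m + 1) s + flat (m + 2) s) (at s)"
proof -
  consider "0 < s" | "s < 0" | "s = 0" by linarith
  then show ?thesis
  proof cases
    case 1
    have "((\<lambda>s. inverse s ^ m * exp (- inverse s)) has_real_derivative
        - real m * flat (m + 1) s + flat (m + 2) s) (at s)"
    proof (cases m)
      case 0
      then show ?thesis
        using 1 by (auto intro!: derivative_eq_intros simp: flat_def power2_eq_square)
    next
      case (Suc l)
      then show ?thesis
        using 1 by (auto intro!: derivative_eq_intros
            simp: flat_def algebra_simps power2_eq_square simp flip: power_Suc)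
    qed
    then show ?thesis
      by (rule has_field_derivative_transform_within_open[of _ _ _ "{0<..}"])
         (use 1 in \<open>auto simp: flat_def\<close>)
  next
    case 2
    have "((\<lambda>s. 0) has_real_derivative - real m * flat (m + 1) s + flat (m + 2) s) (at s)"
      using 2 by (auto simp: flat_def)
    then show ?thesis
      by (rule has_field_derivative_transform_within_open[of _ _ _ "{..<0}"])
         (use 2 in \<open>auto simp: flat_def\<close>)
  next
    case 3
    have "((\<lambda>h. flat m h / h) \<longlongrightarrow> 0) (at 0)"
      by (rule Lim_transform_eventually[OF flat_tendsto_0[of "m + 1"]])
         (auto simp: flat_def eventually_at_filter field_simps)
    then show ?thesis
      using 3 by (simp add: DERIV_def flat_def)
  qed
qed

lemma C_on_flat: "C_on k UNIV (flat m)"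
proof (induction k arbitrary: m)
  case 0
  then show ?case
    using DERIV_isCont[OF flat_deriv] by (auto intro!: continuous_at_imp_continuous_on)
next
  case (Suc k)
  have "C_on k UNIV (\<lambda>s. - real m * flat (m + 1) s + flat (m + 2) s)"
    by (intro C_on_add C_on_bilinear[OF _ bounded_bilinear_mult] C_on_const Suc) auto
  then show ?case
    by (rule C_on_realI[rotated 2]) (use flat_deriv in auto)
qed


section \<open>Charts and transition maps\<close>

lemma chart_inv_left: "is_chart X c \<Longrightarrow> p \<in> fst c \<Longrightarrow> chart_inv c (snd c p) = p"
  using openin_subset[of X "fst c"]
  by (auto simp: is_chart_def chart_inv_def homeomorphic_map_def Int_absorb1)

lemma chart_inv_right: "x \<in> chart_image c \<Longrightarrow> snd c (chart_inv c x) = x"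
  by (simp add: chart_image_def chart_inv_def f_inv_into_f)

lemma chart_inv_in: "x \<in> chart_image c \<Longrightarrow> chart_inv c x \<in> fst c"
  by (simp add: chart_image_def chart_inv_def inv_into_into)

lemma chart_in_image: "p \<in> fst c \<Longrightarrow> snd c p \<in> chart_image c"
  by (simp add: chart_image_def)

lemma chart_maps:
  assumes "is_chart X c"
  shows "homeomorphic_maps (subtopology X (fst c)) (top_of_set (chart_image c)) (snd c) (chart_inv c)"
proof -
  have sub: "topspace (subtopology X (fst c)) = fst c"
    using assms openin_subset[of X "fst c"] by (auto simp: is_chart_def)
  obtain g where g: "homeomorphic_maps (subtopology X (fst c)) (top_of_set (chart_image c)) (snd c) g"
    using assms by (auto simp: is_chart_def homeomorphic_map_maps)
  have "g x = chart_inv c x" if "x \<in> chart_image c" for x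
  proof -
    have "g (snd c (chart_inv c x)) = chart_inv c x"
      using g chart_inv_in[OF that] sub unfolding homeomorphic_maps_def by blast
    then show ?thesis using chart_inv_right[OF that] by simp
  qed
  then show ?thesis
    using g sub chart_inv_left[OF assms] chart_inv_right
    unfolding homeomorphic_maps_def by (auto intro: continuous_map_eq)
qed

lemma chart_inv_continuous:
  assumes "is_chart X c"
  shows "continuous_map (top_of_set (chart_image c)) X (chart_inv c)"
  using chart_maps[OF assms] by (auto simp: homeomorphic_maps_def continuous_map_in_subtopology)

lemma open_chart_image:
  assumes "is_chart X c" and "openin X U"
  shows "open (snd c ` (fst c \<inter> U))"
proof -
  have "openin (subtopology X (fst c)) (fst c \<inter> U)"
    using assms(2) by (simp add: openin_subtopology_Int2)
  then have "openin (top_of_set (chart_image c)) (snd c ` (fst c \<inter> U))"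
    using assms(1) homeomorphic_imp_open_map unfolding is_chart_def open_map_def by blast
  then show ?thesis
    using assms(1) openin_open_eq by (auto simp: is_chart_def)
qed

lemma open_chart_vimage:
  assumes "is_chart X c" and "open W"
  shows "openin X {q \<in> fst c. snd c q \<in> W}"
proof -
  have "openin (subtopology X (fst c)) {q \<in> topspace (subtopology X (fst c)). snd c q \<in> chart_image c \<inter> W}"
    using chart_maps[OF assms(1)] assms(2) unfolding homeomorphic_maps_def
    by (intro openin_continuous_map_preimage[where Y = "top_of_set (chart_image c)"])
       (auto intro: openin_open_Int)
  moreover have "{q \<in> topspace (subtopology X (fst c)). snd c q \<in> chart_image c \<inter> W}
      = {q \<in> fst c. snd c q \<in> W}"
    using assms(1) openin_subset[of X "fst c"] by (auto simp: is_chart_def chart_in_image)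
  ultimately show ?thesis
    using assms(1) openin_trans_full unfolding is_chart_def by metis
qed

lemma bounded_bilinear_matrix_mult:
  "bounded_bilinear ((**) :: real^'n^'n \<Rightarrow> real^'n^'n \<Rightarrow> real^'n^'n)"
  unfolding bilinear_conv_bounded_bilinear[symmetric] bilinear_def
  by (intro conjI allI linearI)
     (auto simp: matrix_matrix_mult_def vec_eq_iff distrib_left distrib_right sum.distrib
        sum_distrib_left mult_ac)

lemma bounded_linear_transpose: "bounded_linear (transpose :: real^'n^'n \<Rightarrow> real^'n^'n)"
  unfolding linear_conv_bounded_linear[symmetric]
  by (rule linearI) (auto simp: transpose_def vec_eq_iff)

text \<open>The matrix of a linear map is a sum over \<open>j\<close> of fixed linear functions of the images
  of the basis vectors; these images are the quantities that \<open>C_on\<close> controls.\<close>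

lemma C_on_matrix:
  fixes f :: "'a::real_normed_vector \<Rightarrow> real^'n \<Rightarrow> real^'n"
  assumes "open S" and "\<And>v. C_on k S (\<lambda>x. f x v)"
  shows "C_on k S (\<lambda>x. matrix (f x))"
proof -
  \<comment> \<open>\<open>L j v\<close> is the matrix with column \<open>j\<close> equal to \<open>v\<close> and all others 0\<close>
  define L :: "'n \<Rightarrow> real^'n \<Rightarrow> real^'n^'n" where
    "L j v = (\<chi> i l. if l = j then v $ i else 0)" for j v
  have L: "bounded_linear (L j)" for j
    unfolding linear_conv_bounded_linear[symmetric]
    by (rule linearI) (auto simp: L_def vec_eq_iff)
  have "matrix (f x) = (\<Sum>j\<in>UNIV. L j (f x (axis j 1)))" for x
    by (simp add: matrix_def L_def vec_eq_iff)
  moreover have "C_on k S (\<lambda>x. \<Sum>j\<in>UNIV. L j (f x (axis j 1)))"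
    by (intro C_on_sum assms(1) C_on_compose[OF assms(1) _ open_UNIV assms(2) C_on_linear[OF open_UNIV L]])
       auto
  ultimately show ?thesis by simp
qed

locale manifold =
  fixes X :: "'a topology" and A :: "('a, 'n::finite) chart set"
  assumes compact_smooth_manifold: "compact_smooth_manifold X A"
begin

lemma chart: "c \<in> A \<Longrightarrow> is_chart X c"
  and transition_smooth: "c \<in> A \<Longrightarrow> d \<in> A \<Longrightarrow> smooth_on (snd c ` (fst c \<inter> fst d)) (transition c d)"
  and covered: "(\<Union>c\<in>A. fst c) = topspace X"
  using compact_smooth_manifold by (auto simp: compact_smooth_manifold_def smooth_atlas_def)

lemma chart_open: "c \<in> A \<Longrightarrow> openin X (fst c)" and image_open: "c \<in> A \<Longrightarrow> open (chart_image c)"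
  using chart by (auto simp: is_chart_def)

lemma overlap_open: "c \<in> A \<Longrightarrow> d \<in> A \<Longrightarrow> open (snd c ` (fst c \<inter> fst d))"
  using open_chart_image chart chart_open by blast

lemmas inv_left = chart_inv_left[OF chart]

lemma continuous_from_charts:
  fixes f :: "'a \<Rightarrow> 'b::topological_space"
  assumes "\<And>c. c \<in> A \<Longrightarrow> continuous_on (chart_image c) (\<lambda>x. f (chart_inv c x))"
  shows "continuous_map X euclidean f"
  unfolding continuous_map
proof (intro conjI allI impI)
  fix V :: "'b set" assume "openin euclidean V"
  then have V: "open V" by simp
  show "openin X {p \<in> topspace X. f p \<in> V}"
  proof (subst openin_subopen, intro ballI)
    fix p assume "p \<in> {p \<in> topspace X. f p \<in> V}"
    then have p: "p \<in> topspace X" "f p \<in> V" by auto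
    obtain c where c: "c \<in> A" "p \<in> fst c" using p(1) covered by blast
    let ?W = "{x \<in> chart_image c. f (chart_inv c x) \<in> V}"
    have "open ?W"
      using continuous_open_preimage[OF assms[OF c(1)] image_open[OF c(1)] V]
      by (simp add: vimage_def Int_def)
    then have "openin X {q \<in> fst c. snd c q \<in> ?W}"
      by (rule open_chart_vimage[OF chart[OF c(1)]])
    moreover have "p \<in> {q \<in> fst c. snd c q \<in> ?W}"
      using c p(2) by (simp add: chart_in_image inv_left)
    moreover have "{q \<in> fst c. snd c q \<in> ?W} \<subseteq> {p \<in> topspace X. f p \<in> V}"
      using c(1) covered inv_left[OF c(1)] by auto
    ultimately show "\<exists>T. openin X T \<and> p \<in> T \<and> T \<subseteq> {p \<in> topspace X. f p \<in> V}" by blast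
  qed
qed auto

lemma transition_has_derivative:
  assumes "c \<in> A" "d \<in> A" "p \<in> fst c" "p \<in> fst d"
  shows "(transition c d has_derivative (\<lambda>v. jacobian c d p *v v)) (at (snd c p))"
proof -
  let ?D = "frechet_derivative (transition c d) (at (snd c p))"
  have "C_on (Suc 0) (snd c ` (fst c \<inter> fst d)) (transition c d)"
    using transition_smooth[OF assms(1,2)] unfolding smooth_on_def by blast
  then have D: "(transition c d has_derivative ?D) (at (snd c p))"
    by (rule C_on_SucD(1)) (use assms(3,4) in auto)
  then have "linear ?D" by (rule has_derivative_linear)
  then have "jacobian c d p *v v = ?D v" for v
    by (simp add: jacobian_def matrix_works)
  then show ?thesis using D by simp
qed

lemma jacobian_cocycle:
  assumes "c \<in> A" "d \<in> A" "e \<in> A" "p \<in> fst c" "p \<in> fst d" "p \<in> fst e"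
  shows "jacobian c e p = jacobian d e p ** jacobian c d p"
proof -
  have tr: "transition c d (snd c p) = snd d p"
    by (simp add: transition_def inv_left[OF assms(1,4)])
  have "((\<lambda>x. transition d e (transition c d x)) has_derivative
      (\<lambda>v. jacobian d e p *v (jacobian c d p *v v))) (at (snd c p))"
    by (rule has_derivative_compose[OF transition_has_derivative[OF assms(1,2,4,5)]])
       (use transition_has_derivative[OF assms(2,3,5,6)] tr in simp)
  moreover have "transition d e (transition c d x) = transition c e x"
    if "x \<in> snd c ` (fst c \<inter> fst d)" for x
    using that by (auto simp: transition_def inv_left assms)
  moreover have "snd c p \<in> snd c ` (fst c \<inter> fst d)"
    using assms by auto
  ultimately have "(transition c e has_derivative
      (\<lambda>v. jacobian d e p *v (jacobian c d p *v v))) (at (snd c p))"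
    using has_derivative_transform_within_open[OF _ overlap_open[OF assms(1,2)]] by blast
  then have "(\<lambda>v. jacobian d e p *v (jacobian c d p *v v)) = (\<lambda>v. jacobian c e p *v v)"
    by (rule has_derivative_unique) (rule transition_has_derivative[OF assms(1,3,4,6)])
  then show ?thesis
    by (metis matrix_eq matrix_vector_mul_assoc)
qed

lemma jacobian_self:
  assumes "c \<in> A" "p \<in> fst c"
  shows "jacobian c c p = mat 1"
proof -
  have "((\<lambda>x. x) has_derivative (\<lambda>v. v)) (at (snd c p))" by simp
  then have "(transition c c has_derivative (\<lambda>v. v)) (at (snd c p))"
    by (rule has_derivative_transform_within_open[OF _ image_open[OF assms(1)]])
       (use assms in \<open>auto simp: transition_def chart_in_image chart_inv_right\<close>)
  then have "(\<lambda>v. v) = (\<lambda>v. jacobian c c p *v v)"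
    by (rule has_derivative_unique) (rule transition_has_derivative[OF assms(1,1,2,2)])
  then show ?thesis
    by (metis matrix_eq matrix_vector_mul_lid)
qed

text \<open>By the cocycle rule the Jacobian has the one of the opposite transition as a left inverse.\<close>

lemma jacobian_inj:
  assumes "c \<in> A" "d \<in> A" "p \<in> fst c" "p \<in> fst d" "v \<noteq> 0"
  shows "jacobian c d p *v v \<noteq> 0"
proof
  assume "jacobian c d p *v v = 0"
  then have "jacobian c c p *v v = 0"
    using jacobian_cocycle[of c d c p] assms by (simp flip: matrix_vector_mul_assoc)
  then show False using assms by (simp add: jacobian_self)
qed

lemma C_on_jacobian:
  assumes "c \<in> A" "d \<in> A"
  shows "C_on k (snd c ` (fst c \<inter> fst d)) (\<lambda>x. jacobian c d (chart_inv c x))"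
proof (rule C_on_cong[OF overlap_open[OF assms]])
  show "C_on k (snd c ` (fst c \<inter> fst d)) (\<lambda>x. matrix (frechet_derivative (transition c d) (at x)))"
    using transition_smooth[OF assms]
    by (intro C_on_matrix overlap_open[OF assms] C_on_SucD(2)) (auto simp only: smooth_on_def)
qed (auto simp: jacobian_def inv_left assms)

end

section \<open>Bump functions, partitions of unity and existence of a metric\<close>

lemma inner_transpose_mult_self: "v \<bullet> ((transpose J ** J) *v v) = (J *v v) \<bullet> (J *v (v :: real^'n))"
proof -
  have "(transpose J ** J) *v v = (J *v v) v* J"
    by (simp only: matrix_vector_mul_assoc[symmetric] transpose_matrix_vector)
  then show ?thesis
    by (simp only: dot_lmul_matrix inner_commute[of v])
qed

lemma bounded_linear_quadratic: "bounded_linear (\<lambda>M :: real^'n^'n. v \<bullet> (M *v v))"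
  unfolding linear_conv_bounded_linear[symmetric]
  by (rule linearI)
     (auto simp: matrix_vector_mult_add_rdistrib inner_add_right scaleR_matrix_vector_assoc[symmetric])

context manifold
begin

text \<open>The compact support makes the extension by 0 smooth: off the support, which is closed because the
  manifold is Hausdorff, the function vanishes.\<close>

definition chart_bump :: "('a, 'n) chart \<Rightarrow> ('a \<Rightarrow> real) \<Rightarrow> bool" where
  "chart_bump c \<phi> \<longleftrightarrow> (\<forall>p. 0 \<le> \<phi> p) \<and>
     (\<forall>d\<in>A. smooth_on (chart_image d) (\<lambda>x. \<phi> (chart_inv d x))) \<and>
     (\<exists>K. compactin X K \<and> K \<subseteq> fst c \<and> (\<forall>p\<in>topspace X - K. \<phi> p = 0))"

lemma compactin_closed: "compactin X K \<Longrightarrow> closedin X K"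
  using compact_smooth_manifold compactin_imp_closedin unfolding compact_smooth_manifold_def by blast

text \<open>For gluing along \<open>K\<close>: points of \<open>K\<close> have the overlap of the two charts
  as a neighbourhood, all other points have one on which \<open>f\<close> vanishes.\<close>

lemma C_on_off_compact:
  fixes f :: "real ^ 'n \<Rightarrow> 'b::real_normed_vector"
  assumes d: "d \<in> A" and K: "compactin X K" "K \<subseteq> fst c" and c: "c \<in> A"
    and zero: "\<And>p. p \<in> fst d - K \<Longrightarrow> f (snd d p) = 0"
    and smooth: "C_on k (snd d ` (fst d \<inter> fst c)) f"
  shows "C_on k (chart_image d) f"
proof (rule C_on_local)
  fix x assume x: "x \<in> chart_image d"
  then obtain p where p: "p \<in> fst d" "x = snd d p" by (auto simp: chart_image_def)
  show "\<exists>T. open T \<and> x \<in> T \<and> C_on k T f"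
  proof (cases "p \<in> K")
    case True
    then have "x \<in> snd d ` (fst d \<inter> fst c)"
      using p K(2) by blast
    then show ?thesis
      using overlap_open[OF d c] smooth by blast
  next
    case False
    let ?T = "snd d ` (fst d \<inter> (topspace X - K))"
    have T: "open ?T"
      using open_chart_image[OF chart[OF d]] compactin_closed[OF K(1)] by blast
    have "f y = 0" if "y \<in> ?T" for y
      using that zero by blast
    then have "C_on k ?T f"
      by (intro C_on_cong[OF T _ C_on_const[of k ?T 0]]) simp
    moreover have "x \<in> ?T"
      using p False openin_subset[OF chart_open[OF d]] by blast
    ultimately show ?thesis using T by (intro exI[of _ ?T]) simp
  qed
qed

text \<open>In the chart the function is \<open>exp (- 1 / (e\<^sup>2 - \<bar>x -
  x\<^sub>0\<bar>\<^sup>2))\<close> on a ball whose closure lies in the chart image.\<close>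

lemma chart_bump_exists:
  assumes "p \<in> topspace X"
  shows "\<exists>c \<phi>. c \<in> A \<and> chart_bump c \<phi> \<and> 0 < \<phi> p"
proof -
  obtain c where c: "c \<in> A" "p \<in> fst c" using assms covered by blast
  obtain e where e: "0 < e" "cball (snd c p) e \<subseteq> chart_image c"
    using image_open[OF c(1)] chart_in_image[OF c(2)] open_contains_cball by blast
  let ?x = "snd c p"
  define \<phi> where "\<phi> q = (if q \<in> fst c then flat 0 (e\<^sup>2 - (snd c q - ?x) \<bullet> (snd c q - ?x)) else 0)" for q
  define K where "K = chart_inv c ` cball ?x e"
  have "continuous_map (top_of_set (cball ?x e)) X (chart_inv c)"
    using chart_inv_continuous[OF chart[OF c(1)]] e(2)
    by (metis continuous_map_from_subtopology_mono)
  then have K: "compactin X K"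
    unfolding K_def by (rule image_compactin[rotated]) simp
  have Kc: "K \<subseteq> fst c"
    using e(2) unfolding K_def by (blast intro: chart_inv_in)
  have zero: "\<phi> q = 0" if "q \<notin> K" for q
  proof (cases "q \<in> fst c")
    case True
    have "snd c q \<notin> cball ?x e"
      using that inv_left[OF c(1) True] by (metis K_def imageI)
    then have "e \<le> norm (snd c q - ?x)" by (simp add: dist_norm norm_minus_commute)
    then have "e\<^sup>2 \<le> (norm (snd c q - ?x))\<^sup>2" using e(1) by (simp add: power_mono)
    then show ?thesis
      using flat_pos_iff[of 0 "e\<^sup>2 - (norm (snd c q - ?x))\<^sup>2"] flat_nonneg[of 0 "e\<^sup>2 - (norm (snd c q - ?x))\<^sup>2"]
      by (simp add: \<phi>_def power2_norm_eq_inner)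
  qed (simp add: \<phi>_def)
  have "C_on k (chart_image d) (\<lambda>x. \<phi> (chart_inv d x))" if d: "d \<in> A" for d k
  proof (rule C_on_off_compact[OF d K Kc c(1)])
    show "\<phi> (chart_inv d (snd d q)) = 0" if "q \<in> fst d - K" for q
      using that zero inv_left[OF d] by auto
    let ?S = "snd d ` (fst d \<inter> fst c)"
    have S: "open ?S" by (rule overlap_open[OF d c(1)])
    have diff: "C_on k ?S (\<lambda>x. transition d c x + - ?x)"
      by (rule C_on_add[OF S transition_smooth[OF d c(1), unfolded smooth_on_def, rule_format] C_on_const])
    have "C_on k ?S (\<lambda>x. e\<^sup>2 + (- 1) * ((transition d c x + - ?x) \<bullet> (transition d c x + - ?x)))"
      by (intro C_on_add[OF S] C_on_const C_on_bilinear[OF S bounded_bilinear_mult]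
          C_on_bilinear[OF S bounded_bilinear_inner] diff)
    then have "C_on k ?S (\<lambda>x. flat 0 (e\<^sup>2 + (- 1) * ((transition d c x + - ?x) \<bullet> (transition d c x + - ?x))))"
      by (rule C_on_compose[OF S subset_UNIV open_UNIV _ C_on_flat])
    then show "C_on k ?S (\<lambda>x. \<phi> (chart_inv d x))"
      by (rule C_on_cong[OF S, rotated]) (clarsimp simp: \<phi>_def transition_def inv_left[OF d])
  qed
  moreover have "0 \<le> \<phi> q" for q by (simp add: \<phi>_def flat_nonneg)
  ultimately have "chart_bump c \<phi>"
    unfolding chart_bump_def smooth_on_def
    by (intro conjI ballI allI exI[of _ K] K Kc) (simp_all add: zero)
  moreover have "0 < \<phi> p"
    using c e(1) by (simp add: \<phi>_def flat_pos_iff)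
  ultimately show ?thesis using c(1) by blast
qed

lemma chart_bump_continuous:
  assumes "chart_bump c \<phi>"
  shows "continuous_map X euclideanreal \<phi>"
proof (rule continuous_from_charts)
  fix d assume "d \<in> A"
  then have "smooth_on (chart_image d) (\<lambda>x. \<phi> (chart_inv d x))"
    using assms by (simp add: chart_bump_def)
  then have "C_on 0 (chart_image d) (\<lambda>x. \<phi> (chart_inv d x))"
    unfolding smooth_on_def ..
  then show "continuous_on (chart_image d) (\<lambda>x. \<phi> (chart_inv d x))" by simp
qed

lemma chart_bump_nonneg: "chart_bump c \<phi> \<Longrightarrow> 0 \<le> \<phi> p"
  by (simp add: chart_bump_def)

text \<open>One bump function per point is positive near that point; compactness leaves finitely many.\<close>

lemma finite_bumps:
  obtains P :: "'a set" and c \<phi> where "finite P" "\<And>i. i \<in> P \<Longrightarrow> c i \<in> A"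
    "\<And>i. i \<in> P \<Longrightarrow> chart_bump (c i) (\<phi> i)" "\<And>p. p \<in> topspace X \<Longrightarrow> 0 < (\<Sum>i\<in>P. \<phi> i p)"
proof -
  define c where "c p = (SOME c. \<exists>\<phi>. c \<in> A \<and> chart_bump c \<phi> \<and> 0 < \<phi> p)" for p
  define \<phi> where "\<phi> p = (SOME \<phi>. c p \<in> A \<and> chart_bump (c p) \<phi> \<and> 0 < \<phi> p)" for p
  have "\<exists>\<phi>. c p \<in> A \<and> chart_bump (c p) \<phi> \<and> 0 < \<phi> p" if "p \<in> topspace X" for p
    unfolding c_def by (rule someI_ex[OF chart_bump_exists[OF that]])
  then have b: "c p \<in> A \<and> chart_bump (c p) (\<phi> p) \<and> 0 < \<phi> p p" if "p \<in> topspace X" for p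
    unfolding \<phi>_def by (rule someI_ex) (rule that)
  let ?U = "\<lambda>p. {q \<in> topspace X. \<phi> p q \<in> {0<..}}"
  have "openin X (?U p)" if "p \<in> topspace X" for p
    by (rule openin_continuous_map_preimage[OF chart_bump_continuous[of "c p"]])
       (use b[OF that] in simp_all)
  then have op: "openin X u" if "u \<in> ?U ` topspace X" for u using that by (elim imageE) simp
  have cov: "topspace X \<subseteq> \<Union>(?U ` topspace X)"
  proof
    fix p assume p: "p \<in> topspace X"
    then have "p \<in> ?U p" using b[OF p] by simp
    with p show "p \<in> \<Union>(?U ` topspace X)" by (rule UN_I)
  qed
  have cpt: "compactin X (topspace X)"
    using compact_smooth_manifold by (simp add: compact_smooth_manifold_def compact_space_def)
  obtain \<U> where U: "finite \<U>" "\<U> \<subseteq> ?U ` topspace X" "topspace X \<subseteq> \<Union>\<U>"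
    using compactinD[OF cpt, of "?U ` topspace X"] op cov by (metis (no_types, lifting))
  obtain P where P: "P \<subseteq> topspace X" "finite P" "\<U> = ?U ` P"
    using finite_subset_image[OF U(1,2)] by (elim bexE exE conjE)
  have "0 < (\<Sum>i\<in>P. \<phi> i p)" if p: "p \<in> topspace X" for p
  proof -
    obtain i where i: "i \<in> P" "0 < \<phi> i p" using subsetD[OF U(3) p] unfolding P(3) by auto
    show ?thesis
      by (rule sum_pos2[where f = "\<lambda>i. \<phi> i p", OF P(2) i], rule chart_bump_nonneg) (use b P(1) in blast)
  qed
  moreover have "c i \<in> A" "chart_bump (c i) (\<phi> i)" if "i \<in> P" for i
    using b[of i] P(1) that by (simp_all add: subsetD)
  ultimately show ?thesis using that[of P c \<phi>] P(2) by simp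
qed

text \<open>Several bumps may live in the same chart, whereas a partition of unity is indexed by charts. Hence
  the bumps are grouped by chart before they are divided by the total sum.\<close>

lemma partition_of_unity_exists: "\<exists>F \<rho>. partition_of_unity X A F \<rho>"
proof -
  obtain P :: "'a set" and c \<phi> where P: "finite P" "\<And>i. i \<in> P \<Longrightarrow> c i \<in> A"
    and b: "\<And>i. i \<in> P \<Longrightarrow> chart_bump (c i) (\<phi> i)"
    and pos: "\<And>p. p \<in> topspace X \<Longrightarrow> 0 < (\<Sum>i\<in>P. \<phi> i p)"
    by (rule finite_bumps) (rule that)
  define \<rho> where "\<rho> d p = (\<Sum>i\<in>{i\<in>P. c i = d}. \<phi> i p) / (\<Sum>i\<in>P. \<phi> i p)" for d p
  have "partition_of_unity X A (c ` P) \<rho>"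
    unfolding partition_of_unity_def
  proof (intro conjI ballI)
    fix d assume "d \<in> c ` P"
    show "continuous_map X euclideanreal (\<rho> d)"
      unfolding \<rho>_def
    proof (intro continuous_map_real_divide continuous_map_sum)
      show "(\<Sum>i\<in>P. \<phi> i p) \<noteq> 0" if "p \<in> topspace X" for p
        using pos[OF that] by simp
    qed (simp_all add: P(1) chart_bump_continuous[OF b])
    show "0 \<le> \<rho> d p" if "p \<in> topspace X" for p
      unfolding \<rho>_def by (intro divide_nonneg_nonneg sum_nonneg) (simp_all add: chart_bump_nonneg[OF b])
    have "\<forall>i\<in>P. \<exists>K. compactin X K \<and> K \<subseteq> fst (c i) \<and> (\<forall>p\<in>topspace X - K. \<phi> i p = 0)"
      using b by (simp add: chart_bump_def)
    from bchoice[OF this] obtain K where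
      "\<forall>i\<in>P. compactin X (K i) \<and> K i \<subseteq> fst (c i) \<and> (\<forall>p\<in>topspace X - K i. \<phi> i p = 0)" ..
    then have K: "\<And>i. i \<in> P \<Longrightarrow> compactin X (K i)" "\<And>i. i \<in> P \<Longrightarrow> K i \<subseteq> fst (c i)"
        "\<And>i p. i \<in> P \<Longrightarrow> p \<in> topspace X - K i \<Longrightarrow> \<phi> i p = 0"
      by simp_all
    let ?K = "\<Union>i\<in>{i\<in>P. c i = d}. K i"
    have "{p \<in> topspace X. \<rho> d p \<noteq> 0} \<subseteq> ?K"
    proof
      fix p assume "p \<in> {p \<in> topspace X. \<rho> d p \<noteq> 0}"
      then have p: "p \<in> topspace X" "(\<Sum>i\<in>{i\<in>P. c i = d}. \<phi> i p) \<noteq> 0" by (auto simp: \<rho>_def)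
      obtain i where i: "i \<in> {i\<in>P. c i = d}" "\<phi> i p \<noteq> 0"
        using sum.not_neutral_contains_not_neutral[OF p(2)] .
      then have "p \<in> K i" using K(3)[of i p] p(1) by auto
      with i(1) show "p \<in> ?K" by (rule UN_I)
    qed
    moreover have "closedin X ?K"
      using P(1) by (intro closedin_Union) (auto intro!: compactin_closed K(1))
    ultimately have "X closure_of {p \<in> topspace X. \<rho> d p \<noteq> 0} \<subseteq> ?K"
      by (rule closure_of_minimal)
    then show "X closure_of {p \<in> topspace X. \<rho> d p \<noteq> 0} \<subseteq> fst d"
      using K(2) by blast
  next
    fix p assume p: "p \<in> topspace X"
    have "(\<Sum>d\<in>c ` P. \<Sum>i\<in>{i\<in>P. c i = d}. \<phi> i p) = (\<Sum>i\<in>P. \<phi> i p)"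
      using P(1) by (intro sum.group) auto
    then show "(\<Sum>d\<in>c ` P. \<rho> d p) = 1"
      using pos[OF p] by (simp add: \<rho>_def flip: sum_divide_distrib)
  next
    show "finite (c ` P)" "c ` P \<subseteq> A" using P by auto
  qed
  then show ?thesis by blast
qed

text \<open>The metric is the sum of the Euclidean metrics of finitely many charts, weighted by bump
  functions: in a chart \<open>d\<close> the Euclidean metric of the chart \<open>c i\<close> is
  \<open>J\<^sup>T J\<close> for the Jacobian \<open>J\<close> of the transition from
  \<open>d\<close>.\<close>

lemma metric_exists: "metrics X A \<noteq> {}"
proof -
  obtain P :: "'a set" and c \<phi> where P: "finite P" "\<And>i. i \<in> P \<Longrightarrow> c i \<in> A"
    and b: "\<And>i. i \<in> P \<Longrightarrow> chart_bump (c i) (\<phi> i)"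
    and pos: "\<And>p. p \<in> topspace X \<Longrightarrow> 0 < (\<Sum>i\<in>P. \<phi> i p)"
    by (rule finite_bumps) (rule that)
  define h where "h i d p = \<phi> i p *\<^sub>R (transpose (jacobian d (c i) p) ** jacobian d (c i) p)" for i d p
  define g where "g d p = (if d \<in> A \<and> p \<in> fst d then \<Sum>i\<in>P. h i d p else 0)" for d p
  have off: "\<phi> i p = 0" if i: "i \<in> P" and p: "p \<in> topspace X" "p \<notin> fst (c i)" for i p
  proof -
    obtain K where "K \<subseteq> fst (c i)" "\<forall>p\<in>topspace X - K. \<phi> i p = 0"
      using b[OF i] unfolding chart_bump_def by (elim conjE exE) (rule that)
    then show ?thesis using p by (meson DiffI subsetD)
  qed
  have top: "p \<in> topspace X" if "d \<in> A" "p \<in> fst d" for d p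
    using that covered by blast
  interpret mm: bounded_bilinear "(**) :: real^'n^'n \<Rightarrow> real^'n^'n \<Rightarrow> real^'n^'n" by (rule bounded_bilinear_matrix_mult)
  have "transpose (h i d p) = h i d p" for i d p
    by (simp add: h_def linear_cmul[OF bounded_linear.linear[OF bounded_linear_transpose]] matrix_transpose_mul)
  then have sym: "transpose (g d p) = g d p" if "d \<in> A" "p \<in> fst d" for d p
    using that by (simp add: g_def linear_sum[OF bounded_linear.linear[OF bounded_linear_transpose]])
  have trans: "g d p = transpose (jacobian d e p) ** g e p ** jacobian d e p"
    if d: "d \<in> A" "p \<in> fst d" and e: "e \<in> A" "p \<in> fst e" for d e p
  proof -
    have "h i d p = transpose (jacobian d e p) ** h i e p ** jacobian d e p" if i: "i \<in> P" for i
    proof (cases "p \<in> fst (c i)")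
      case True
      then show ?thesis
        using jacobian_cocycle[OF d(1) e(1) P(2)[OF i] d(2) e(2)]
        by (simp add: h_def matrix_transpose_mul matrix_mul_assoc mm.scaleR_left mm.scaleR_right)
    next
      case False
      then show ?thesis
        using off[OF i top[OF d]] by (simp add: h_def mm.zero_left mm.zero_right)
    qed
    then show ?thesis
      using d e by (simp add: g_def mm.sum_left mm.sum_right)
  qed
  have smooth: "C_on k (chart_image d) (\<lambda>x. g d (chart_inv d x))" if d: "d \<in> A" for d k
  proof -
    have "C_on k (chart_image d) (\<lambda>x. h i d (chart_inv d x))" if i: "i \<in> P" for i
    proof -
      obtain K where K: "compactin X K" "K \<subseteq> fst (c i)" "\<forall>p\<in>topspace X - K. \<phi> i p = 0"
        using b[OF i] unfolding chart_bump_def by (elim conjE exE) (rule that)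
      let ?S = "snd d ` (fst d \<inter> fst (c i))"
      have S: "open ?S" by (rule overlap_open[OF d P(2)[OF i]])
      have J: "C_on k ?S (\<lambda>x. jacobian d (c i) (chart_inv d x))"
        by (rule C_on_jacobian[OF d P(2)[OF i]])
      have "C_on k (chart_image d) (\<lambda>x. \<phi> i (chart_inv d x))"
        using b[OF i] d by (simp add: chart_bump_def smooth_on_def)
      then have \<phi>: "C_on k ?S (\<lambda>x. \<phi> i (chart_inv d x))"
        by (rule C_on_subset) (auto simp: chart_image_def)
      then have "C_on k ?S (\<lambda>x. h i d (chart_inv d x))"
        unfolding h_def
        by (intro C_on_bilinear[OF S bounded_bilinear_scaleR \<phi>]
            C_on_bilinear[OF S bounded_bilinear_matrix_mult _ J]
            C_on_compose[OF S subset_UNIV open_UNIV J C_on_linear[OF open_UNIV bounded_linear_transpose]])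
      then show ?thesis
        by (rule C_on_off_compact[OF d K(1,2) P(2)[OF i], rotated])
           (simp add: h_def inv_left[OF d] K(3) top[OF d])
    qed
    then have "C_on k (chart_image d) (\<lambda>x. \<Sum>i\<in>P. h i d (chart_inv d x))"
      by (intro C_on_sum image_open d)
    then show ?thesis
      by (rule C_on_cong[OF image_open[OF d], rotated]) (simp add: g_def d chart_inv_in)
  qed
  have positive: "0 < v \<bullet> (g d p *v v)" if d: "d \<in> A" "p \<in> fst d" and v: "v \<noteq> 0" for d p v
  proof -
    let ?q = "\<lambda>i. \<phi> i p * ((jacobian d (c i) p *v v) \<bullet> (jacobian d (c i) p *v v))"
    have "v \<bullet> (h i d p *v v) = ?q i" for i
      by (simp add: h_def inner_transpose_mult_self scaleR_matrix_vector_assoc[symmetric])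
    then have q: "v \<bullet> (g d p *v v) = (\<Sum>i\<in>P. ?q i)"
      using d by (simp add: g_def linear_sum[OF bounded_linear.linear[OF bounded_linear_quadratic[of v]]])
    have "(\<Sum>i\<in>P. \<phi> i p) \<noteq> 0" using pos[OF top[OF d]] by simp
    then obtain i where i: "i \<in> P" "\<phi> i p \<noteq> 0"
      by (rule sum.not_neutral_contains_not_neutral)
    then have "0 < \<phi> i p" using chart_bump_nonneg[OF b[OF i(1)], of p] by simp
    moreover have "p \<in> fst (c i)"
      using off[OF i(1) top[OF d]] i(2) by blast
    then have "jacobian d (c i) p *v v \<noteq> 0"
      by (intro jacobian_inj d P(2) i(1) v)
    ultimately have "0 < ?q i" by simp
    then show ?thesis
      unfolding q by (rule sum_pos2[OF P(1) i(1)]) (simp add: chart_bump_nonneg[OF b])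
  qed
  have "g \<in> sym_tensors X A"
    unfolding sym_tensors_def smooth_on_def
  proof (intro CollectI conjI allI ballI impI)
    show "g d p = 0" if "d \<notin> A \<or> p \<notin> fst d" for d p
      using that unfolding g_def by auto
    show "g d p = transpose (jacobian d e p) ** g e p ** jacobian d e p"
      if "d \<in> A" "e \<in> A" "p \<in> fst d \<inter> fst e" for d e p
      using that by (intro trans) simp_all
  qed (rule sym smooth; assumption)+
  then have "g \<in> metrics X A"
    unfolding metrics_def by (intro CollectI conjI allI ballI impI positive)
  then show ?thesis by (rule ex_in_conv[THEN iffD1, OF exI])
qed

end

section \<open>Positive definite matrices and volume\<close>

definition posdef :: "real^'n^'n \<Rightarrow> bool" where
  "posdef M \<longleftrightarrow> (\<forall>v. v \<noteq> 0 \<longrightarrow> 0 < v \<bullet> (M *v v))"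

lemma posdef_det_nz:
  assumes "posdef M" shows "det M \<noteq> 0"
proof -
  have "v = 0" if "M *v v = 0" for v
    using assms that unfolding posdef_def by (metis inner_zero_right less_irrefl)
  then have "invertible M"
    by (simp add: invertible_left_inverse matrix_left_invertible_ker)
  then show ?thesis by (simp add: invertible_det_nz)
qed

lemma posdef_convex_identity:
  assumes "posdef M" "0 \<le> t" "t \<le> 1"
  shows "posdef ((1 - t) *\<^sub>R mat 1 + t *\<^sub>R M)"
  unfolding posdef_def
proof (intro allI impI)
  fix v :: "real^'a" assume v: "v \<noteq> 0"
  have M: "0 < v \<bullet> (M *v v)" using assms(1) v by (simp add: posdef_def)
  have "v \<bullet> (((1 - t) *\<^sub>R mat 1 + t *\<^sub>R M) *v v) = (1 - t) * (v \<bullet> v) + t * (v \<bullet> (M *v v))"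
    by (simp add: matrix_vector_mult_add_rdistrib inner_add_right scaleR_matrix_vector_assoc[symmetric])
  moreover have "0 < (1 - t) * (v \<bullet> v) + t * (v \<bullet> (M *v v))"
  proof (cases "t = 0")
    case False
    then show ?thesis using assms M by (intro add_nonneg_pos) auto
  qed (use v in simp)
  ultimately show "0 < v \<bullet> (((1 - t) *\<^sub>R mat 1 + t *\<^sub>R M) *v v)" by simp
qed

lemma continuous_on_det:
  fixes f :: "'a::topological_space \<Rightarrow> real^'n^'n"
  shows "continuous_on S f \<Longrightarrow> continuous_on S (\<lambda>x. det (f x))"
  unfolding det_def by (intro continuous_intros)

text \<open>On the segment from the identity to \<open>M\<close> all matrices are positive definite, hence
  invertible, so the determinant keeps its sign.\<close>

lemma posdef_det_pos:
  assumes "posdef M" shows "0 < det M"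
proof (rule ccontr)
  assume "\<not> 0 < det M"
  then have "det M \<le> 0" by simp
  let ?h = "\<lambda>t. det ((1 - t) *\<^sub>R mat 1 + t *\<^sub>R M)"
  have "\<exists>t\<ge>0. t \<le> 1 \<and> ?h t = 0"
    by (rule IVT2'[of ?h]) (use \<open>det M \<le> 0\<close> in \<open>auto intro!: continuous_on_det continuous_intros simp: det_I\<close>)
  then show False
    using posdef_det_nz posdef_convex_identity[OF assms] by blast
qed

lemma posdef_inverse:
  assumes "posdef M" shows "matrix_inv M ** M = mat 1"
proof -
  have "invertible M" using posdef_det_nz[OF assms] by (simp add: invertible_det_nz)
  then show ?thesis
    unfolding invertible_def matrix_inv_def by (rule someI2_ex) simp
qed

lemma posdef_scaleR:
  assumes "posdef M" "0 < r" shows "posdef (r *\<^sub>R M)"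
  using assms by (simp add: posdef_def scaleR_matrix_vector_assoc[symmetric])

lemma det_scaleR: "det (r *\<^sub>R M) = r ^ CARD('n) * det (M :: real^'n^'n)"
proof -
  have "r *\<^sub>R M = mat r ** M"
    by (simp add: matrix_eq scaleR_matrix_vector_assoc[symmetric] matrix_scaleR[symmetric]
        matrix_vector_mul_assoc[symmetric] matrix_works[of "(*\<^sub>R) r"] linear_scaleR)
  then show ?thesis by (simp add: det_mul flip: matrix_scaleR)
qed

text \<open>The compact \<open>K\<close> carries the function and makes it integrable. This is essential for
  the strict inequality, because the integral of a non-integrable function is 0 by convention.\<close>

lemma bump_set_integral:
  fixes w :: "'a::euclidean_space \<Rightarrow> real"
  assumes "open S" "compact K" "K \<subseteq> S" "continuous_on S w" "\<And>x. x \<in> S \<Longrightarrow> 0 \<le> w x"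
    and "\<And>x. x \<in> S - K \<Longrightarrow> w x = 0"
  shows "0 \<le> (LINT x:S|lborel. w x)"
    and "x\<^sub>0 \<in> S \<Longrightarrow> 0 < w x\<^sub>0 \<Longrightarrow> 0 < (LINT x:S|lborel. w x)"
proof -
  show "0 \<le> (LINT x:S|lborel. w x)"
    unfolding set_lebesgue_integral_def
    by (rule Bochner_Integration.integral_nonneg) (auto simp: indicator_def assms(5))
  assume x: "x\<^sub>0 \<in> S" "0 < w x\<^sub>0"
  have "integrable lborel (\<lambda>x. indicator K x *\<^sub>R w x)"
    using assms by (intro borel_integrable_compact continuous_on_subset[OF assms(4)])
  moreover have "(\<lambda>x. indicator K x *\<^sub>R w x) = (\<lambda>x. indicator S x *\<^sub>R w x)"
    using assms(3,6) by (intro ext) (auto simp: indicator_def)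
  ultimately have int: "integrable lborel (\<lambda>x. indicator S x *\<^sub>R w x)" by (simp only:)
  have "open (S \<inter> w -` {w x\<^sub>0 / 2<..})"
    using continuous_open_preimage[OF assms(4,1) open_greaterThan] .
  moreover have "x\<^sub>0 \<in> S \<inter> w -` {w x\<^sub>0 / 2<..}" using x by simp
  ultimately obtain e where e: "0 < e" "cball x\<^sub>0 e \<subseteq> S \<inter> w -` {w x\<^sub>0 / 2<..}"
    using open_contains_cball by blast
  have "0 < w x\<^sub>0 / 2 * measure lborel (cball x\<^sub>0 e)"
    using content_cball_pos[OF e(1)] x(2) by simp
  also have "\<dots> = (LINT x|lborel. indicator (cball x\<^sub>0 e) x *\<^sub>R (w x\<^sub>0 / 2))"
    by (simp add: mult.commute)
  also have "\<dots> \<le> (LINT x|lborel. indicator S x *\<^sub>R w x)"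
  proof (rule integral_mono[OF _ int])
    show "integrable lborel (\<lambda>x. indicator (cball x\<^sub>0 e) x *\<^sub>R (w x\<^sub>0 / 2))"
      by (rule borel_integrable_compact) auto
    show "indicator (cball x\<^sub>0 e) x *\<^sub>R (w x\<^sub>0 / 2) \<le> indicator S x *\<^sub>R w x" for x
      using subsetD[OF e(2), of x] assms(5)[of x] by (auto simp: indicator_def)
  qed
  finally show "0 < (LINT x:S|lborel. w x)" by (simp add: set_lebesgue_integral_def)
qed

context manifold
begin

lemma metric_tensor: "g \<in> metrics X A \<Longrightarrow> g \<in> sym_tensors X A"
  by (simp add: metrics_def)

lemma metric_posdef: "g \<in> metrics X A \<Longrightarrow> c \<in> A \<Longrightarrow> p \<in> fst c \<Longrightarrow> posdef (g c p)"
  by (simp add: metrics_def posdef_def)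

lemma tensor_off: "h \<in> sym_tensors X A \<Longrightarrow> c \<notin> A \<or> p \<notin> fst c \<Longrightarrow> h c p = 0"
  unfolding sym_tensors_def mem_Collect_eq by (elim conjE allE[where x = c] allE[where x = p]) (erule mp)

lemma tensor_smooth: "h \<in> sym_tensors X A \<Longrightarrow> c \<in> A \<Longrightarrow> C_on k (chart_image c) (\<lambda>x. h c (chart_inv c x))"
  unfolding sym_tensors_def smooth_on_def by simp

abbreviation chosen_partition :: "('a, 'n) chart set \<times> (('a, 'n) chart \<Rightarrow> 'a \<Rightarrow> real)" where
  "chosen_partition \<equiv> SOME P. partition_of_unity X A (fst P) (snd P)"

text \<open>The integral refers to one fixed but arbitrary partition of unity; all that is known about it is
  this property.\<close>

lemma chosen_partition: "partition_of_unity X A (fst chosen_partition) (snd chosen_partition)"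
proof -
  obtain F \<rho> where "partition_of_unity X A F \<rho>"
    using partition_of_unity_exists by (elim exE)
  then have "partition_of_unity X A (fst (F, \<rho>)) (snd (F, \<rho>))" by simp
  then show ?thesis by (rule someI)
qed

text \<open>All metrics are integrated with the same partition of unity, so the integrands can be compared
  chart by chart; a constant factor passes through the integral even where a non-integrable function is given
  the value 0.\<close>

lemma vol_integral_cmul:
  assumes "\<And>c p. c \<in> A \<Longrightarrow> p \<in> fst c \<Longrightarrow> f c p * sqrt (det (g c p)) = a * (f' c p * sqrt (det (g' c p)))"
  shows "vol_integral X A g f = a * vol_integral X A g' f'"
proof -
  let ?F = "fst chosen_partition" and ?\<rho> = "snd chosen_partition"
  have F: "?F \<subseteq> A" using chosen_partition by (simp add: partition_of_unity_def)
  have "(LINT x:chart_image c|lborel. ?\<rho> c (chart_inv c x) * f c (chart_inv c x) * sqrt (det (g c (chart_inv c x))))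
      = a * (LINT x:chart_image c|lborel. ?\<rho> c (chart_inv c x) * f' c (chart_inv c x) * sqrt (det (g' c (chart_inv c x))))"
    if c: "c \<in> ?F" for c
  proof -
    have "indicator (chart_image c) x *\<^sub>R (?\<rho> c (chart_inv c x) * f c (chart_inv c x) * sqrt (det (g c (chart_inv c x))))
        = a * (indicator (chart_image c) x *\<^sub>R
            (?\<rho> c (chart_inv c x) * f' c (chart_inv c x) * sqrt (det (g' c (chart_inv c x)))))" for x
    proof (cases "x \<in> chart_image c")
      case True
      then show ?thesis
        using assms[OF subsetD[OF F c] chart_inv_in[OF True]] by (simp add: mult.assoc mult.left_commute)
    qed simp
    then show ?thesis
      unfolding set_lebesgue_integral_def by (simp only: integral_mult_right_zero)
  qed
  then show ?thesis
    unfolding vol_integral_def Let_def sum_distrib_left by (rule sum.cong[OF refl])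
qed

lemma Vol_pos:
  assumes g: "g \<in> metrics X A" and ne: "topspace X \<noteq> {}"
  shows "0 < Vol X A g"
proof -
  let ?F = "fst chosen_partition" and ?\<rho> = "snd chosen_partition"
  let ?w = "\<lambda>c x. ?\<rho> c (chart_inv c x) * 1 * sqrt (det (g c (chart_inv c x)))"
  have F: "finite ?F" "?F \<subseteq> A"
    and cont: "\<And>c. c \<in> ?F \<Longrightarrow> continuous_map X euclideanreal (?\<rho> c)"
    and nonneg: "\<And>c p. c \<in> ?F \<Longrightarrow> p \<in> topspace X \<Longrightarrow> 0 \<le> ?\<rho> c p"
    and supp: "\<And>c. c \<in> ?F \<Longrightarrow> X closure_of {p \<in> topspace X. ?\<rho> c p \<noteq> 0} \<subseteq> fst c"
    and one: "\<And>p. p \<in> topspace X \<Longrightarrow> (\<Sum>c\<in>?F. ?\<rho> c p) = 1"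
    using chosen_partition unfolding partition_of_unity_def by simp_all
  have top: "chart_inv c x \<in> topspace X" if "c \<in> A" "x \<in> chart_image c" for c x
    using chart_inv_in[OF that(2)] openin_subset[OF chart_open[OF that(1)]] by blast
  have det: "0 < det (g c (chart_inv c x))" if "c \<in> A" "x \<in> chart_image c" for c x
    by (rule posdef_det_pos[OF metric_posdef[OF g that(1) chart_inv_in[OF that(2)]]])
  have K: "\<exists>K. compact K \<and> K \<subseteq> chart_image c \<and> (\<forall>x\<in>chart_image c - K. ?w c x = 0)"
    if c: "c \<in> ?F" for c
  proof (intro exI conjI ballI)
    have cA: "c \<in> A" using c F(2) by blast
    let ?C = "X closure_of {p \<in> topspace X. ?\<rho> c p \<noteq> 0}"
    have "compactin X ?C"
      using compact_smooth_manifold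
      by (intro closedin_compact_space) (simp_all add: compact_smooth_manifold_def)
    then have "compactin (subtopology X (fst c)) ?C"
      using supp[OF c] by (simp add: compactin_subtopology)
    then have "compactin (top_of_set (chart_image c)) (snd c ` ?C)"
      by (rule image_compactin) (use chart_maps[OF chart[OF cA]] in \<open>simp add: homeomorphic_maps_def\<close>)
    then show "compact (snd c ` ?C)" "snd c ` ?C \<subseteq> chart_image c"
      by (simp_all add: compactin_subtopology)
    fix x assume x: "x \<in> chart_image c - snd c ` ?C"
    have "chart_inv c x \<notin> ?C"
    proof
      assume "chart_inv c x \<in> ?C"
      then have "snd c (chart_inv c x) \<in> snd c ` ?C" by (rule imageI)
      then show False using x chart_inv_right[of x c] by simp
    qed
    then have "?\<rho> c (chart_inv c x) = 0"
      using top[OF cA, of x] x closure_of_subset[of "{p \<in> topspace X. ?\<rho> c p \<noteq> 0}" X] by blast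
    then show "?w c x = 0" by simp
  qed
  have cont_w: "continuous_on (chart_image c) (?w c)" if c: "c \<in> ?F" for c
  proof -
    have cA: "c \<in> A" using c F(2) by blast
    have "continuous_on (chart_image c) (\<lambda>x. ?\<rho> c (chart_inv c x))"
      using continuous_map_compose[OF chart_inv_continuous[OF chart[OF cA]] cont[OF c]]
      by (simp add: o_def)
    moreover have "continuous_on (chart_image c) (\<lambda>x. g c (chart_inv c x))"
      using tensor_smooth[OF metric_tensor[OF g] cA, of 0] by simp
    ultimately show ?thesis by (intro continuous_intros continuous_on_det)
  qed
  have w0: "0 \<le> ?w c x" if "c \<in> ?F" "x \<in> chart_image c" for c x
    using nonneg[OF that(1) top] det[of c x] that F(2) by (simp add: subsetD less_imp_le)
  have ge: "0 \<le> (LINT x:chart_image c|lborel. ?w c x)" if c: "c \<in> ?F" for c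
  proof -
    obtain K where "compact K" "K \<subseteq> chart_image c" "\<forall>x\<in>chart_image c - K. ?w c x = 0"
      using K[OF c] by (elim exE conjE)
    then show ?thesis
      using image_open[of c] F(2) c w0[OF c] by (intro bump_set_integral(1)[of _ K] cont_w) (auto simp only:)
  qed
  obtain p where p: "p \<in> topspace X" using ne by blast
  have "(\<Sum>c\<in>?F. ?\<rho> c p) \<noteq> 0" using one[OF p] by simp
  then obtain c where c: "c \<in> ?F" "?\<rho> c p \<noteq> 0"
    by (rule sum.not_neutral_contains_not_neutral)
  have cA: "c \<in> A" using c F(2) by blast
  have "p \<in> X closure_of {p \<in> topspace X. ?\<rho> c p \<noteq> 0}"
    using p c(2) closure_of_subset[of "{p \<in> topspace X. ?\<rho> c p \<noteq> 0}" X] by blast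
  then have pc: "p \<in> fst c" using supp[OF c(1)] by blast
  have "0 < ?w c (snd c p)"
    using nonneg[OF c(1) p] c(2) det[OF cA chart_in_image[OF pc]] by (simp add: inv_left[OF cA pc])
  moreover obtain K where "compact K" "K \<subseteq> chart_image c" "\<forall>x\<in>chart_image c - K. ?w c x = 0"
    using K[OF c(1)] by (elim exE conjE)
  ultimately have "0 < (LINT x:chart_image c|lborel. ?w c x)"
    using w0[OF c(1)]
    by (intro bump_set_integral(2)[OF image_open[OF cA], of K _ "snd c p"] cont_w c(1) chart_in_image pc)
       (auto simp only:)
  then have "0 < (\<Sum>c\<in>?F. LINT x:chart_image c|lborel. ?w c x)"
    by (intro sum_pos2[OF F(1) c(1)] ge)
  then show ?thesis unfolding Vol_def vol_integral_def Let_def .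
qed

lemma Vol_tscale:
  assumes "0 < r"
  shows "Vol X A (tscale r g) = r powr (real CARD('n) / 2) * Vol X A g"
  unfolding Vol_def
proof (rule vol_integral_cmul)
  have "sqrt (r ^ CARD('n)) = r powr (real CARD('n) / 2)"
    using assms by (simp add: powr_half_sqrt[symmetric] powr_realpow[symmetric] powr_powr)
  then show "1 * sqrt (det (tscale r g c p)) = r powr (real CARD('n) / 2) * (1 * sqrt (det (g c p)))" for c p
    by (simp add: tscale_def det_scaleR real_sqrt_mult)
qed

lemma g02_tscale:
  assumes g: "g \<in> metrics X A" "c \<in> A" "p \<in> fst c" and r: "0 < r"
  shows "g02 (tscale r g) (tscale a g) (tscale b g) c p = real CARD('n) * a * b / r\<^sup>2"
    and "matrix_inv (tscale r g c p) ** tscale a g c p = (a / r) *\<^sub>R mat 1"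
proof -
  have *: "matrix_inv (r *\<^sub>R g c p) ** (a *\<^sub>R g c p) = (a / r) *\<^sub>R mat 1" for a
  proof -
    have "a *\<^sub>R g c p = (a / r) *\<^sub>R (r *\<^sub>R g c p)" using r by simp
    then show ?thesis
      using posdef_inverse[OF posdef_scaleR[OF metric_posdef[OF g] r]]
        bounded_bilinear.scaleR_right[OF bounded_bilinear_matrix_mult]
      by metis
  qed
  then show "matrix_inv (tscale r g c p) ** tscale a g c p = (a / r) *\<^sub>R mat 1"
    by (simp add: tscale_def)
  have "g02 (tscale r g) (tscale a g) (tscale b g) c p = trace ((a / r) *\<^sub>R mat 1 ** ((b / r) *\<^sub>R (mat 1 :: real^'n^'n)))"
    by (simp only: g02_def tscale_def matrix_mul_assoc[symmetric] * )
  also have "\<dots> = (a / r * (b / r)) * trace (mat 1 :: real^'n^'n)"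
    by (simp add: bounded_bilinear.scaleR_left[OF bounded_bilinear_matrix_mult]
       bounded_bilinear.scaleR_right[OF bounded_bilinear_matrix_mult] trace_def sum_distrib_left mult_ac)
  also have "\<dots> = real CARD('n) * a * b / r\<^sup>2"
    by (simp add: trace_I power2_eq_square)
  finally show "g02 (tscale r g) (tscale a g) (tscale b g) c p = real CARD('n) * a * b / r\<^sup>2" .
qed

lemma vol_integral_g02_tscale:
  assumes "g \<in> metrics X A" and "0 < r"
  shows "vol_integral X A (tscale r g) (g02 (tscale r g) (tscale a g) (tscale b g)) =
    real CARD('n) * a * b / r\<^sup>2 * Vol X A (tscale r g)"
  unfolding Vol_def by (rule vol_integral_cmul) (simp add: g02_tscale(1) assms)

end

section \<open>Rays as submanifolds\<close>

text \<open>The complement is the projection of a closed set along the compact unit sphere.\<close>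

lemma open_posdef: "open {M :: real^'n^'n. posdef M}"
proof -
  let ?q = "\<lambda>z :: (real^'n) \<times> (real^'n^'n). fst z \<bullet> (snd z *v fst z)"
  have "continuous_on UNIV ?q"
    unfolding inner_vec_def matrix_vector_mult_def vec_lambda_beta inner_real_def
    by (intro continuous_on_sum continuous_on_mult continuous_on_component continuous_on_fst
        continuous_on_snd continuous_on_id)
  then have "closed {z. ?q z \<le> 0}"
    by (rule closed_Collect_le[OF _ continuous_on_const])
  then have closed: "closed {M. \<exists>v. v \<in> sphere 0 1 \<and> (v, M) \<in> {z. ?q z \<le> 0}}"
    by (rule closed_compact_projection[OF compact_sphere])
  have "posdef M \<longleftrightarrow> \<not> (\<exists>v. v \<in> sphere 0 1 \<and> v \<bullet> (M *v v) \<le> 0)" for M :: "real^'n^'n"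
  proof
    assume M: "posdef M"
    show "\<not> (\<exists>v. v \<in> sphere 0 1 \<and> v \<bullet> (M *v v) \<le> 0)"
    proof (intro notI, elim exE conjE)
      fix v :: "real^'n" assume v: "v \<in> sphere 0 1" "v \<bullet> (M *v v) \<le> 0"
      then have "v \<noteq> 0" by auto
      then show False using M v(2) unfolding posdef_def by (meson not_le)
    qed
  next
    assume M: "\<not> (\<exists>v. v \<in> sphere 0 1 \<and> v \<bullet> (M *v v) \<le> 0)"
    show "posdef M"
      unfolding posdef_def
    proof (intro allI impI)
      fix v :: "real^'n" assume v: "v \<noteq> 0"
      let ?u = "(1 / norm v) *\<^sub>R v"
      have "?u \<in> sphere 0 1" using v by simp
      then have "0 < ?u \<bullet> (M *v ?u)" using M not_le by blast
      then show "0 < v \<bullet> (M *v v)"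
        using v by (simp add: matrix_vector_mult_scaleR zero_less_divide_iff)
    qed
  qed
  then have "{M. posdef M} = - {M. \<exists>v. v \<in> sphere 0 1 \<and> (v, M) \<in> {z. ?q z \<le> 0}}"
    by (simp only: mem_Collect_eq fst_conv snd_conv Collect_neg_eq)
  then show ?thesis using open_Compl[OF closed] by (simp only:)
qed

context manifold
begin

lemma tensor_transform:
  assumes h: "h \<in> sym_tensors X A" and c: "c \<in> A" "p \<in> fst c" and d: "d \<in> A" "p \<in> fst d"
  shows "h c p = transpose (jacobian c d p) ** h d p ** jacobian c d p"
proof -
  have "\<forall>c\<in>A. \<forall>d\<in>A. \<forall>p\<in>fst c \<inter> fst d. h c p = transpose (jacobian c d p) ** h d p ** jacobian c d p"
    using h unfolding sym_tensors_def mem_Collect_eq by (elim conjE)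
  from bspec[OF bspec[OF this c(1)] d(1)] show ?thesis using c(2) d(2) by simp
qed

lemma tensor_sym:
  assumes h: "h \<in> sym_tensors X A" and c: "c \<in> A" "p \<in> fst c"
  shows "transpose (h c p) = h c p"
proof -
  have "\<forall>c\<in>A. \<forall>p\<in>fst c. transpose (h c p) = h c p"
    using h unfolding sym_tensors_def mem_Collect_eq by (elim conjE)
  from bspec[OF this c(1)] show ?thesis using c(2) by (rule bspec)
qed

text \<open>Positivity has to be transported between charts, since an atlas may be infinite and openness can
  only be obtained from finitely many charts.\<close>

lemma posdef_transform:
  assumes "h \<in> sym_tensors X A" "c \<in> A" "d \<in> A" "p \<in> fst c" "p \<in> fst d" and pd: "posdef (h c p)"
  shows "posdef (h d p)"
  unfolding posdef_def
proof (intro allI impI)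
  fix v :: "real^'n" assume "v \<noteq> 0"
  then have "0 < (jacobian d c p *v v) \<bullet> (h c p *v (jacobian d c p *v v))"
    using jacobian_inj[OF assms(3,2,5,4)] pd by (simp add: posdef_def)
  also have "\<dots> = v \<bullet> (transpose (jacobian d c p) *v (h c p *v (jacobian d c p *v v)))"
    by (metis dot_lmul_matrix transpose_matrix_vector inner_commute)
  also have "\<dots> = v \<bullet> (h d p *v v)"
    by (simp add: tensor_transform[OF assms(1,3,5,2,4)] matrix_vector_mul_assoc matrix_mul_assoc)
  finally show "0 < v \<bullet> (h d p *v v)" .
qed

lemma tscale_tensor:
  assumes h: "h \<in> sym_tensors X A"
  shows "tscale a h \<in> sym_tensors X A"
  unfolding sym_tensors_def smooth_on_def
proof (intro CollectI conjI allI ballI impI)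
  interpret mm: bounded_bilinear "(**) :: real^'n^'n \<Rightarrow> real^'n^'n \<Rightarrow> real^'n^'n"
    by (rule bounded_bilinear_matrix_mult)
  show "tscale a h c p = 0" if "c \<notin> A \<or> p \<notin> fst c" for c p
    using tensor_off[OF h that] by (simp add: tscale_def)
  show "transpose (tscale a h c p) = tscale a h c p" if "c \<in> A" "p \<in> fst c" for c p
    by (simp add: tscale_def tensor_sym[OF h that]
        linear_cmul[OF bounded_linear.linear[OF bounded_linear_transpose]])
  show "tscale a h c p = transpose (jacobian c d p) ** tscale a h d p ** jacobian c d p"
    if "c \<in> A" "d \<in> A" "p \<in> fst c \<inter> fst d" for c d p
    using tensor_transform[OF h that(1) _ that(2), of p] that(3)
    by (simp add: tscale_def mm.scaleR_left mm.scaleR_right)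
  show "C_on k (chart_image c) (\<lambda>x. tscale a h c (chart_inv c x))" if "c \<in> A" for c k
    unfolding tscale_def
    by (intro C_on_bilinear[OF image_open[OF that] bounded_bilinear_scaleR] C_on_const tensor_smooth h that)
qed

lemma tplus_tscale: "tplus (tscale a g) (tscale b g) = tscale (a + b) g"
  by (simp add: tplus_def tscale_def scaleR_add_left)

lemma tscale_tscale: "tscale a (tscale b g) = tscale (a * b) g"
  by (simp add: tscale_def)

lemma tscale_metric:
  assumes g: "g \<in> metrics X A" and "0 < r"
  shows "tscale r g \<in> metrics X A"
proof -
  have "posdef (tscale r g c p)" if "c \<in> A" "p \<in> fst c" for c p
    unfolding tscale_def by (rule posdef_scaleR[OF metric_posdef[OF g that] \<open>0 < r\<close>])
  then show ?thesis
    using tscale_tensor[OF metric_tensor[OF g]] by (simp add: metrics_def posdef_def)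
qed

lemma ray_subset_metrics: "g \<in> metrics X A \<Longrightarrow> ray g \<subseteq> metrics X A"
  unfolding ray_def by (intro subsetI, elim CollectE exE conjE) (simp add: tscale_metric)

lemma point_exists:
  assumes "topspace X \<noteq> {}"
  obtains c p where "c \<in> A" "p \<in> fst c"
proof -
  obtain p where "p \<in> (\<Union>c\<in>A. fst c)" using assms covered by (metis ex_in_conv)
  then show ?thesis by (elim UN_E) (rule that)
qed

lemma metric_nonzero:
  assumes g: "g \<in> metrics X A" "c \<in> A" "p \<in> fst c"
  shows "g c p \<noteq> 0"
proof
  assume "g c p = 0"
  then have "\<forall>v :: real^'n. v \<noteq> 0 \<longrightarrow> 0 < v \<bullet> (0 *v v)"
    using metric_posdef[OF g] by (simp only: posdef_def)
  from this[rule_format, of "axis undefined 1"] show False by (simp add: axis_eq_0_iff)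
qed

lemma metric_tscale_iff:
  assumes g: "g \<in> metrics X A" and ne: "topspace X \<noteq> {}"
  shows "tscale a g \<in> metrics X A \<longleftrightarrow> 0 < a"
proof
  assume a: "tscale a g \<in> metrics X A"
  obtain c p where cp: "c \<in> A" "p \<in> fst c" using point_exists[OF ne] .
  define v :: "real^'n" where "v = axis undefined 1"
  have v: "v \<noteq> 0" by (simp add: v_def axis_eq_0_iff)
  have "0 < v \<bullet> (tscale a g c p *v v)" "0 < v \<bullet> (g c p *v v)"
    using metric_posdef[OF a cp] metric_posdef[OF g cp] v by (simp_all add: posdef_def)
  then show "0 < a"
    by (simp add: tscale_def scaleR_matrix_vector_assoc[symmetric] zero_less_mult_iff)
qed (rule tscale_metric[OF g])

text \<open>A formula for the factor \<open>a\<close> in \<open>M = a N\<close> that is smooth in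
  \<open>M\<close>.\<close>

definition ratio :: "real^'n^'n \<Rightarrow> real^'n^'n \<Rightarrow> real" where
  "ratio M N = (M \<bullet> N) / (N \<bullet> N)"

lemma ratio_scaleR: "N \<noteq> 0 \<Longrightarrow> ratio (a *\<^sub>R N) N = a"
  by (simp add: ratio_def)

lemma smooth_path_component:
  assumes "smooth_path_on X A UNIV \<gamma>" "c \<in> A" "p \<in> fst c"
  shows "C_on k UNIV (\<lambda>t. \<gamma> t c p)"
proof -
  let ?T = "UNIV \<times> chart_image c"
  have T: "open (?T :: (real \<times> (real^'n)) set)" by (intro open_Times open_UNIV image_open assms)
  have outer: "C_on k ?T (\<lambda>(t, x). \<gamma> t c (chart_inv c x))"
    using assms(1,2) by (simp add: smooth_path_on_def smooth_on_def)
  have inner: "C_on k UNIV (\<lambda>t::real. (t, snd c p))"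
  proof -
    have lin: "bounded_linear (\<lambda>t::real. (t, 0::real^'n))"
      by (intro bounded_linear_Pair bounded_linear_ident bounded_linear_zero)
    have "C_on k UNIV (\<lambda>t::real. (t, 0) + (0, snd c p))"
      by (rule C_on_add[OF open_UNIV C_on_linear[OF open_UNIV lin] C_on_const])
    then show ?thesis by simp
  qed
  have "range (\<lambda>t::real. (t, snd c p)) \<subseteq> ?T"
    using chart_in_image[OF assms(3)] by (intro image_subsetI) simp
  from C_on_compose[OF open_UNIV this T inner outer]
  have "C_on k UNIV (\<lambda>t. case (t, snd c p) of (t, x) \<Rightarrow> \<gamma> t c (chart_inv c x))" .
  then show ?thesis by (simp add: inv_left[OF assms(2,3)])
qed

lemma smooth_path_continuous:
  assumes "smooth_path_on X A UNIV \<gamma>"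
  shows "continuous_on UNIV (\<lambda>t. \<gamma> t c p)"
proof (cases "c \<in> A \<and> p \<in> fst c")
  case True
  then show ?thesis using smooth_path_component[OF assms, of c p 0] by simp
next
  case False
  have "\<gamma> t c p = 0" for t
    using assms False by (intro tensor_off) (auto simp: smooth_path_on_def)
  then show ?thesis by simp
qed

lemma smooth_path_tscale:
  assumes h: "h \<in> sym_tensors X A" and I: "open I" and r: "smooth_on I r"
  shows "smooth_path_on X A I (\<lambda>t. tscale (r t) h)"
  unfolding smooth_path_on_def smooth_on_def
proof (intro conjI ballI allI)
  show "tscale (r t) h \<in> sym_tensors X A" for t by (rule tscale_tensor[OF h])
  fix c k assume c: "c \<in> A"
  let ?T = "I \<times> chart_image c"
  have T: "open ?T" by (intro open_Times I image_open c)
  have "C_on k ?T (\<lambda>z. r (fst z) *\<^sub>R h c (chart_inv c (snd z)))"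
  proof (intro C_on_bilinear[OF T bounded_bilinear_scaleR])
    show "C_on k ?T (\<lambda>z. r (fst z))"
      using r by (intro C_on_compose[OF T _ I C_on_linear[OF T bounded_linear_fst]])
        (auto simp: smooth_on_def)
    show "C_on k ?T (\<lambda>z. h c (chart_inv c (snd z)))"
      by (intro C_on_compose[OF T _ image_open[OF c] C_on_linear[OF T bounded_linear_snd] tensor_smooth[OF h c]])
         auto
  qed
  then show "C_on k ?T (\<lambda>(t, x). tscale (r t) h c (chart_inv c x))"
    by (simp add: tscale_def split_beta')
qed

text \<open>Positivity at a point and a time persists for nearby points and times; compactness of the manifold
  then gives a neighbourhood of the time that works for all points.\<close>

lemma open_metrics: "open_tensors X A (metrics X A)"
  unfolding open_tensors_def
proof (intro conjI allI impI)
  show "metrics X A \<subseteq> sym_tensors X A" by (auto simp: metrics_def)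
  fix \<gamma> assume path: "smooth_path_on X A UNIV \<gamma>"
  have tensor: "\<gamma> t \<in> sym_tensors X A" for t
    using path by (simp add: smooth_path_on_def)
  show "open {t. \<gamma> t \<in> metrics X A}"
  proof (subst open_subopen, intro ballI)
    fix t0 assume "t0 \<in> {t. \<gamma> t \<in> metrics X A}"
    then have t0: "\<gamma> t0 \<in> metrics X A" by simp
    have loc: "\<exists>U V. openin X U \<and> p \<in> U \<and> open V \<and> t0 \<in> V \<and>
        (\<forall>q\<in>U. \<forall>t\<in>V. \<forall>c\<in>A. q \<in> fst c \<longrightarrow> posdef (\<gamma> t c q))" if p: "p \<in> topspace X" for p
    proof -
      obtain c where c: "c \<in> A" "p \<in> fst c" using p covered by (metis UN_E)
      let ?S = "UNIV \<times> chart_image c" and ?f = "\<lambda>(t, x). \<gamma> t c (chart_inv c x)"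
      have S: "open (?S :: (real \<times> (real^'n)) set)"
        by (intro open_Times open_UNIV image_open c)
      have "C_on 0 ?S ?f"
        using path c(1) unfolding smooth_path_on_def smooth_on_def by (elim conjE) (drule (1) bspec, rule spec)
      then have "continuous_on ?S ?f" by simp
      then have "open (?S \<inter> ?f -` {M. posdef M})"
        by (rule continuous_open_preimage[OF _ S open_posdef])
      then obtain V W where VW: "open V" "open W" "(t0, snd c p) \<in> V \<times> W"
          "V \<times> W \<subseteq> ?S \<inter> ?f -` {M. posdef M}"
      proof (rule open_prod_elim)
        show "(t0, snd c p) \<in> ?S \<inter> ?f -` {M. posdef M}"
          using metric_posdef[OF t0 c] by (simp add: inv_left[OF c] chart_in_image[OF c(2)])
      qed (rule that)
      have "posdef (\<gamma> t d q)" if q: "q \<in> fst c" "snd c q \<in> W" and t: "t \<in> V" and d: "d \<in> A" "q \<in> fst d" for q t d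
      proof -
        have "posdef (\<gamma> t c q)"
          using subsetD[OF VW(4), of "(t, snd c q)"] q t by (simp add: inv_left[OF c(1)])
        then show ?thesis
          by (rule posdef_transform[OF tensor c(1) d(1) q(1) d(2)])
      qed
      then show ?thesis
        using open_chart_vimage[OF chart[OF c(1)] VW(2)] VW(1,3) c(2)
        by (intro exI[of _ "{q \<in> fst c. snd c q \<in> W}"] exI[of _ V]) simp
    qed
    let ?Q = "\<lambda>U V. open V \<and> t0 \<in> V \<and> (\<forall>q\<in>U. \<forall>t\<in>V. \<forall>c\<in>A. q \<in> fst c \<longrightarrow> posdef (\<gamma> t c q))"
    let ?\<U> = "{U. openin X U \<and> (\<exists>V. ?Q U V)}"
    have cov: "topspace X \<subseteq> \<Union>?\<U>"
    proof
      fix p assume "p \<in> topspace X"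
      from loc[OF this] obtain U V where "openin X U \<and> p \<in> U \<and> ?Q U V"
        by (elim exE) (rule that)
      then show "p \<in> \<Union>?\<U>" by (intro UnionI[of U] CollectI conjI exI[of _ V]) simp_all
    qed
    have cpt: "compactin X (topspace X)"
      using compact_smooth_manifold by (simp add: compact_smooth_manifold_def compact_space_def)
    have "\<exists>\<F>. finite \<F> \<and> \<F> \<subseteq> ?\<U> \<and> topspace X \<subseteq> \<Union>\<F>"
      by (rule compactinD[OF cpt _ cov]) simp
    then obtain \<F> where F: "finite \<F>" "\<F> \<subseteq> ?\<U>" "topspace X \<subseteq> \<Union>\<F>"
      by (elim exE conjE)
    have "\<forall>U\<in>\<F>. \<exists>V. ?Q U V" using F(2) by blast
    from bchoice[OF this] obtain V where V: "\<forall>U\<in>\<F>. ?Q U (V U)" ..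
    have "open (\<Inter>U\<in>\<F>. V U)" using F(1) V by (intro open_INT) simp_all
    moreover have "t0 \<in> (\<Inter>U\<in>\<F>. V U)" using V by simp
    moreover have "\<gamma> t \<in> metrics X A" if t: "t \<in> (\<Inter>U\<in>\<F>. V U)" for t
    proof -
      have "posdef (\<gamma> t c q)" if c: "c \<in> A" "q \<in> fst c" for c q
      proof -
        have "q \<in> topspace X" using c openin_subset[OF chart_open[OF c(1)]] by blast
        then obtain U where U: "U \<in> \<F>" "q \<in> U" using F(3) by blast
        then have "t \<in> V U" using t by blast
        then show ?thesis using bspec[OF V U(1)] U(2) c by simp
      qed
      then show ?thesis using tensor by (simp add: metrics_def posdef_def)
    qed
    ultimately show "\<exists>T. open T \<and> t0 \<in> T \<and> T \<subseteq> {t. \<gamma> t \<in> metrics X A}"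
      by (intro exI[of _ "\<Inter>U\<in>\<F>. V U"] conjI subsetI CollectI)
  qed
qed


lemma velocity_tscale:
  assumes "(\<rho> has_real_derivative d) (at t)"
  shows "velocity (\<lambda>t. tscale (\<rho> t) g) t = tscale d g"
proof (intro ext)
  fix c p
  have "((\<lambda>s. \<rho> s *\<^sub>R g c p) has_vector_derivative d *\<^sub>R g c p) (at t)"
    using has_vector_derivative_scaleR[OF assms has_vector_derivative_const] by simp
  then show "velocity (\<lambda>t. tscale (\<rho> t) g) t c p = tscale d g c p"
    by (simp add: velocity_def tscale_def vector_derivative_at)
qed

lemma ratio_tscale:
  "g \<in> metrics X A \<Longrightarrow> c \<in> A \<Longrightarrow> p \<in> fst c \<Longrightarrow> ratio (tscale a g c p) (g c p) = a"
  by (simp add: tscale_def ratio_scaleR metric_nonzero)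

text \<open>Along a path, membership in the line is the closed condition that every component equals the
  corresponding component of \<open>\<rho>(t) g\<close>, where the candidate factor \<open>\<rho>(t)\<close>
  is read off continuously from a single component.\<close>

lemma line_closed_subspace:
  assumes g: "g \<in> metrics X A" and ne: "topspace X \<noteq> {}"
  shows "closed_subspace X A (range (\<lambda>a. tscale a g))"
  unfolding closed_subspace_def
proof (intro conjI ballI allI)
  let ?F = "range (\<lambda>a. tscale a g)"
  show "?F \<subseteq> sym_tensors X A"
    by (intro image_subsetI tscale_tensor metric_tensor g)
  show "(\<lambda>c p. 0) \<in> ?F"
    by (rule range_eqI[of _ _ 0]) (simp add: tscale_def)
  show "tplus h k \<in> ?F" if "h \<in> ?F" "k \<in> ?F" for h k
    using that by (elim imageE) (simp only: tplus_tscale, rule rangeI)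
  show "tscale a h \<in> ?F" if "h \<in> ?F" for a h
    using that by (elim imageE) (simp only: tscale_tscale, rule rangeI)
  obtain c\<^sub>0 p\<^sub>0 where cp: "c\<^sub>0 \<in> A" "p\<^sub>0 \<in> fst c\<^sub>0" using point_exists[OF ne] .
  show "open_tensors X A (sym_tensors X A - ?F)"
    unfolding open_tensors_def
  proof (intro conjI allI impI)
    fix \<gamma> assume path: "smooth_path_on X A UNIV \<gamma>"
    let ?\<rho> = "\<lambda>t. ratio (\<gamma> t c\<^sub>0 p\<^sub>0) (g c\<^sub>0 p\<^sub>0)"
    have "\<gamma> t \<in> ?F \<longleftrightarrow> (\<forall>c p. \<gamma> t c p = ?\<rho> t *\<^sub>R g c p)" for t
    proof
      assume "\<gamma> t \<in> ?F"
      then obtain a where a: "\<gamma> t = tscale a g" by (elim imageE)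
      have "?\<rho> t = a" unfolding a by (rule ratio_tscale[OF g cp])
      then show "\<forall>c p. \<gamma> t c p = ?\<rho> t *\<^sub>R g c p"
        by (simp only: a) (simp add: tscale_def)
    next
      assume eq: "\<forall>c p. \<gamma> t c p = ?\<rho> t *\<^sub>R g c p"
      have "\<gamma> t = tscale (?\<rho> t) g"
        unfolding tscale_def by (intro ext) (rule eq[THEN spec, THEN spec])
      then show "\<gamma> t \<in> ?F" by (rule range_eqI)
    qed
    moreover have "continuous_on UNIV ?\<rho>"
      unfolding ratio_def
      by (intro continuous_on_divide continuous_on_inner continuous_on_const smooth_path_continuous[OF path])
        (simp add: metric_nonzero[OF g cp])
    then have "closed {t. \<forall>c p. \<gamma> t c p = ?\<rho> t *\<^sub>R g c p}"
      by (intro closed_Collect_all closed_Collect_eq continuous_on_scaleR continuous_on_const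
          smooth_path_continuous[OF path])
    ultimately have "closed {t. \<gamma> t \<in> ?F}" by (simp only:)
    then have "open (- {t. \<gamma> t \<in> ?F})" by (rule open_Compl)
    moreover have "{t. \<gamma> t \<in> sym_tensors X A - ?F} = - {t. \<gamma> t \<in> ?F}"
    proof -
      have "\<gamma> t \<in> sym_tensors X A" for t using path by (simp add: smooth_path_on_def)
      then show ?thesis by (simp only: Diff_iff Compl_eq mem_Collect_eq simp_thms)
    qed
    ultimately show "open {t. \<gamma> t \<in> sym_tensors X A - ?F}" by (simp only:)
  qed (rule Diff_subset)
qed

text \<open>The whole space of metrics is the domain of the chart, and the chart is the identity: the metrics
  among the multiples of \<open>g\<close> are exactly the positive multiples.\<close>

lemma submanifold_ray:
  assumes g: "g \<in> metrics X A" and ne: "topspace X \<noteq> {}"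
  shows "submanifold X A (ray g)"
  unfolding submanifold_def
proof (intro conjI ballI exI)
  show "ray g \<subseteq> metrics X A" by (rule ray_subset_metrics[OF g])
  let ?M = "metrics X A"
  show "g' \<in> ?M" if "g' \<in> ray g" for g'
    using ray_subset_metrics[OF g] that by (rule subsetD)
  show "bij_betw (\<lambda>h. h) ?M ?M" by (simp add: bij_betw_def)
  show "smooth_map X A ?M (\<lambda>h. h)" by (simp add: smooth_map_def)
  have "inv_into ?M (\<lambda>h. h) h = h" if "h \<in> ?M" for h
    by (rule inv_into_f_eq[OF _ that]) simp_all
  then show "smooth_map X A ?M (inv_into ?M (\<lambda>h. h))" by (simp add: smooth_map_def)
  show "closed_subspace X A (range (\<lambda>a. tscale a g))" by (rule line_closed_subspace[OF g ne])
  have "?M \<inter> ray g = ?M \<inter> range (\<lambda>a. tscale a g)"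
  proof (intro set_eqI iffI IntI; elim IntE)
    fix h assume "h \<in> ray g"
    then show "h \<in> range (\<lambda>a. tscale a g)"
      unfolding ray_def by (elim CollectE exE conjE) (rule range_eqI)
  next
    fix h assume h: "h \<in> ?M" "h \<in> range (\<lambda>a. tscale a g)"
    then obtain a where a: "h = tscale a g" by (elim imageE)
    then have "0 < a" using h(1) metric_tscale_iff[OF g ne] by simp
    then show "h \<in> ray g" unfolding ray_def a by (intro CollectI exI[of _ a] conjI refl)
  qed
  then show "(\<lambda>h. h) ` (?M \<inter> ray g) = ?M \<inter> range (\<lambda>a. tscale a g)" by simp
qed (rule open_metrics order_refl)+

lemma tangent_ray_subset:
  assumes g: "g \<in> metrics X A" and ne: "topspace X \<noteq> {}" and h: "h \<in> tangent_space X A (ray g) g'"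
  obtains a where "h = tscale a g"
proof -
  obtain \<gamma> where path: "smooth_path_on X A UNIV \<gamma>" and ray: "\<forall>t. \<gamma> t \<in> ray g" and h: "h = velocity \<gamma> 0"
    using h unfolding tangent_space_def by (elim CollectE exE conjE)
  obtain c p where cp: "c \<in> A" "p \<in> fst c" using point_exists[OF ne] .
  let ?\<rho> = "\<lambda>t. ratio (\<gamma> t c p) (g c p)"
  have \<gamma>: "\<gamma> = (\<lambda>t. tscale (?\<rho> t) g)"
  proof
    fix t
    obtain a where a: "\<gamma> t = tscale a g" using spec[OF ray, of t] unfolding ray_def by (elim CollectE exE conjE)
    then show "\<gamma> t = tscale (?\<rho> t) g" by (simp add: ratio_tscale[OF g cp])
  qed
  have "C_on (Suc 0) UNIV (\<lambda>t. \<gamma> t c p)" by (rule smooth_path_component[OF path cp])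
  then have "(\<lambda>t. \<gamma> t c p) differentiable (at 0)" by simp
  then have "?\<rho> differentiable (at 0)"
    unfolding ratio_def by (simp add: metric_nonzero[OF g cp])
  then obtain d where "(?\<rho> has_real_derivative d) (at 0)"
    using real_differentiable_def by blast
  then have "h = tscale d g"
    unfolding h by (subst \<gamma>) (rule velocity_tscale)
  then show ?thesis by (rule that)
qed

text \<open>The exponential keeps the factor positive for all times, as the definition of the tangent space
  demands of the curve.\<close>

lemma tscale_tangent_ray:
  assumes g: "g \<in> metrics X A" and r: "0 < r"
  shows "tscale b g \<in> tangent_space X A (ray g) (tscale r g)"
proof -
  let ?\<rho> = "\<lambda>t. r * exp (t * (b / r))"
  have "smooth_on UNIV ?\<rho>"
    unfolding smooth_on_def
    by (intro allI C_on_bilinear[OF open_UNIV bounded_bilinear_mult] C_on_const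
        C_on_compose[OF open_UNIV subset_UNIV open_UNIV
          C_on_linear[OF open_UNIV bounded_linear_mult_left] C_on_exp])
  then have path: "smooth_path_on X A UNIV (\<lambda>t. tscale (?\<rho> t) g)"
    by (rule smooth_path_tscale[OF metric_tensor[OF g] open_UNIV])
  have "(?\<rho> has_real_derivative b) (at 0)"
    using r by (auto intro!: derivative_eq_intros)
  then have "tscale b g = velocity (\<lambda>t. tscale (?\<rho> t) g) 0"
    by (rule velocity_tscale[symmetric])
  moreover have "tscale (?\<rho> t) g \<in> ray g" for t
    using r by (auto simp: ray_def)
  moreover have "tscale (?\<rho> 0) g = tscale r g" by simp
  ultimately show ?thesis
    unfolding tangent_space_def using path by (intro CollectI exI[of _ "\<lambda>t. tscale (?\<rho> t) g"] conjI allI)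
qed

text \<open>Where \<open>g\<close> is set to 0 by convention, \<open>matrix_inv\<close> has no useful value;
  but there every summand has a vanishing tensor as a factor.\<close>

lemma Christoffel_tscale:
  assumes g: "g \<in> metrics X A" and r: "0 < r"
  obtains K where "Christoffel X A \<Phi> (tscale r g) (tscale a g) (tscale b g) = tscale K g"
proof -
  let ?n = "real CARD('n)"
  define v where "v = Vol X A (tscale r g)"
  define q where "q = deriv \<Phi> v / \<Phi> v"
  define K where "K = q / 4 * (?n * a * b / r\<^sup>2 * v) * r + ?n * a * b / r\<^sup>2 / 4 * r + a * b / r
    - 1 / 4 * (?n * a * r / r\<^sup>2 * b + ?n * b * r / r\<^sup>2 * a)
    - q / 4 * (?n * a * r / r\<^sup>2 * v * b + ?n * b * r / r\<^sup>2 * v * a)"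
  interpret mm: bounded_bilinear "(**) :: real^'n^'n \<Rightarrow> real^'n^'n \<Rightarrow> real^'n^'n"
    by (rule bounded_bilinear_matrix_mult)
  note int = vol_integral_g02_tscale[OF g r, folded v_def]
  have "Christoffel X A \<Phi> (tscale r g) (tscale a g) (tscale b g) c p = tscale K g c p" for c p
  proof (cases "c \<in> A \<and> p \<in> fst c")
    case True
    then have cp: "c \<in> A" "p \<in> fst c" by auto
    have *: "tscale a g c p ** matrix_inv (tscale r g c p) ** tscale b g c p = (a * b / r) *\<^sub>R g c p" for a b
      by (simp add: matrix_mul_assoc[symmetric] g02_tscale(2)[OF g cp r])
         (simp add: tscale_def mm.scaleR_left mm.scaleR_right)
    show ?thesis
      unfolding Christoffel_def Let_def v_def[symmetric] q_def[symmetric] int * g02_tscale(1)[OF g cp r]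
      by (simp add: tscale_def K_def flip: scaleR_add_left scaleR_diff_left)
  next
    case False
    then have "tscale s g c p = 0" for s
      using tensor_off[OF metric_tensor[OF g]] by (simp add: tscale_def)
    then show ?thesis
      by (simp add: Christoffel_def Let_def mm.zero_left mm.zero_right)
  qed
  then have "Christoffel X A \<Phi> (tscale r g) (tscale a g) (tscale b g) = tscale K g"
    by (intro ext)
  then show ?thesis by (rule that)
qed

lemma totally_geodesic_ray:
  assumes g: "g \<in> metrics X A" and ne: "topspace X \<noteq> {}"
  shows "totally_geodesic X A \<Phi> (ray g)"
  unfolding totally_geodesic_def
proof (intro ballI)
  fix g' h k assume g': "g' \<in> ray g"
    and h: "h \<in> tangent_space X A (ray g) g'" and k: "k \<in> tangent_space X A (ray g) g'"
  obtain r where r: "g' = tscale r g" "0 < r" using g' unfolding ray_def by (elim CollectE exE conjE)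
  obtain a where a: "h = tscale a g" using tangent_ray_subset[OF g ne h] .
  obtain b where b: "k = tscale b g" using tangent_ray_subset[OF g ne k] .
  obtain K where "Christoffel X A \<Phi> (tscale r g) (tscale a g) (tscale b g) = tscale K g"
    using Christoffel_tscale[OF g r(2)] .
  then show "Christoffel X A \<Phi> g' h k \<in> tangent_space X A (ray g) g'"
    unfolding r(1) a b using tscale_tangent_ray[OF g r(2)] by simp
qed

section \<open>Geodesics on a ray\<close>


text \<open>Both sides of the geodesic equation are multiples of \<open>g c p\<close>, with coefficients
  \<open>K t\<close> and \<open>L t\<close>. As \<open>g\<close> vanishes nowhere, one point suffices to
  conclude \<open>K t = L t\<close>.\<close>

lemma geodesic_ray_iff:
  assumes g: "g \<in> metrics X A" and ne: "topspace X \<noteq> {}"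
    and \<Phi>: "smooth_on {0<..} \<Phi>"
    and I: "open I" and r: "smooth_on I r" and r_pos: "\<And>t. t \<in> I \<Longrightarrow> 0 < r t"
  shows "geodesic_on X A \<Phi> I (\<lambda>t. tscale (r t) g) \<longleftrightarrow>
    (\<forall>t\<in>I. let v = Vol X A (tscale (r t) g); n = real CARD('n) in
       deriv (deriv r) t * \<Phi> v =
       (deriv r t)\<^sup>2 / r t * (- n / 4 * deriv \<Phi> v * v + (1 - n / 4) * \<Phi> v))"
proof -
  let ?n = "real CARD('n)" and ?\<gamma> = "\<lambda>t. tscale (r t) g"
  define w where "w t = Vol X A (tscale (r t) g)" for t
  define K where "K t = deriv \<Phi> (w t) * (?n / 2 * w t * deriv r t / r t) * deriv r t
    + \<Phi> (w t) * deriv (deriv r) t" for t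
  define L where "L t = deriv \<Phi> (w t) / 4 * (?n * deriv r t * deriv r t / (r t)\<^sup>2 * w t) * r t
    + \<Phi> (w t) / 4 * (?n * deriv r t * deriv r t / (r t)\<^sup>2) * r t
    + \<Phi> (w t) * (deriv r t * deriv r t / r t)
    - \<Phi> (w t) / 2 * (?n * deriv r t * r t / (r t)\<^sup>2) * deriv r t" for t
  have Ck: "C_on k I r" "C_on k {0<..} \<Phi>" for k
    using r \<Phi> by (simp_all add: smooth_on_def)
  note dr = C_on_realD(1)[OF I Ck(1)]
  note ddr = C_on_realD(1)[OF I C_on_realD(2)[OF I Ck(1)]]
  note d\<Phi> = C_on_realD(1)[OF open_greaterThan Ck(2)]
  have vel: "velocity ?\<gamma> t = tscale (deriv r t) g" if "t \<in> I" for t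
    by (rule velocity_tscale[OF dr[OF that]])
  have metric: "?\<gamma> t \<in> metrics X A" if "t \<in> I" for t
    by (rule tscale_metric[OF g r_pos[OF that]])
  have w_pos: "0 < w t" if "t \<in> I" for t
    unfolding w_def by (rule Vol_pos[OF metric[OF that] ne])
  have w_eq: "w t = r t powr (?n / 2) * Vol X A g" if "t \<in> I" for t
    unfolding w_def by (rule Vol_tscale[OF r_pos[OF that]])
  have dw: "(w has_real_derivative ?n / 2 * w t * deriv r t / r t) (at t)" if t: "t \<in> I" for t
  proof -
    have "((\<lambda>s. r s powr (?n / 2) * Vol X A g) has_real_derivative
        ?n / 2 * r t powr (?n / 2 - 1) * deriv r t * Vol X A g) (at t)"
      by (intro DERIV_cmult_right DERIV_fun_powr[OF dr[OF t] r_pos[OF t], THEN DERIV_cong])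
         (simp add: mult_ac)
    moreover have "?n / 2 * r t powr (?n / 2 - 1) * deriv r t * Vol X A g
        = ?n / 2 * w t * deriv r t / r t"
      using r_pos[OF t] by (simp add: w_eq[OF t] powr_diff)
    ultimately have "((\<lambda>s. r s powr (?n / 2) * Vol X A g) has_real_derivative
        ?n / 2 * w t * deriv r t / r t) (at t)" by (rule DERIV_cong)
    then show ?thesis
      by (rule has_field_derivative_transform_within_open[OF _ I t]) (simp add: w_eq)
  qed
  have lhs: "((\<lambda>s. \<Phi> (w s) *\<^sub>R velocity ?\<gamma> s c p) has_vector_derivative K t *\<^sub>R g c p) (at t)"
    if t: "t \<in> I" for t c p
  proof -
    have "((\<lambda>s. \<Phi> (w s)) has_real_derivative
        deriv \<Phi> (w t) * (?n / 2 * w t * deriv r t / r t)) (at t)"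
      by (rule DERIV_chain2[OF d\<Phi> dw[OF t]]) (simp add: w_pos[OF t])
    then have "((\<lambda>s. \<Phi> (w s) * deriv r s) has_real_derivative K t) (at t)"
      unfolding K_def using ddr[OF t] by (rule DERIV_mult'[THEN DERIV_cong]) simp
    then have "((\<lambda>s. (\<Phi> (w s) * deriv r s) *\<^sub>R g c p) has_vector_derivative K t *\<^sub>R g c p) (at t)"
      using has_vector_derivative_scaleR[OF _ has_vector_derivative_const] by fastforce
    then show ?thesis
      by (rule has_vector_derivative_transform_within_open[OF _ I t]) (simp only: vel, simp add: tscale_def)
  qed
  obtain c\<^sub>0 p\<^sub>0 where cp: "c\<^sub>0 \<in> A" "p\<^sub>0 \<in> fst c\<^sub>0" using point_exists[OF ne] .
  have rhs: "(deriv \<Phi> (w t) / 4 * vol_integral X A (?\<gamma> t) (g02 (?\<gamma> t) (velocity ?\<gamma> t) (velocity ?\<gamma> t))) *\<^sub>R ?\<gamma> t c p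
       + (\<Phi> (w t) / 4 * g02 (?\<gamma> t) (velocity ?\<gamma> t) (velocity ?\<gamma> t) c p) *\<^sub>R ?\<gamma> t c p
       + \<Phi> (w t) *\<^sub>R (velocity ?\<gamma> t c p ** matrix_inv (?\<gamma> t c p) ** velocity ?\<gamma> t c p)
       - (\<Phi> (w t) / 2 * g02 (?\<gamma> t) (velocity ?\<gamma> t) (?\<gamma> t) c p) *\<^sub>R velocity ?\<gamma> t c p = L t *\<^sub>R g c p"
    if t: "t \<in> I" and c: "c \<in> A" "p \<in> fst c" for t c p
  proof -
    interpret mm: bounded_bilinear "(**) :: real^'n^'n \<Rightarrow> real^'n^'n \<Rightarrow> real^'n^'n"
      by (rule bounded_bilinear_matrix_mult)
    have *: "tscale a g c p ** matrix_inv (tscale (r t) g c p) ** tscale b g c p = (a * b / r t) *\<^sub>R g c p" for a b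
      by (simp add: matrix_mul_assoc[symmetric] g02_tscale(2)[OF g c r_pos[OF t]])
         (simp add: tscale_def mm.scaleR_left mm.scaleR_right)
    show ?thesis
      unfolding vel[OF t] vol_integral_g02_tscale[OF g r_pos[OF t], folded w_def] *
        g02_tscale(1)[OF g c r_pos[OF t]]
      by (simp add: tscale_def L_def flip: scaleR_add_left scaleR_diff_left)
  qed
  have pointwise: "(\<forall>c\<in>A. \<forall>p\<in>fst c.
      ((\<lambda>s. \<Phi> (w s) *\<^sub>R velocity ?\<gamma> s c p) has_vector_derivative
        (deriv \<Phi> (w t) / 4 * vol_integral X A (?\<gamma> t) (g02 (?\<gamma> t) (velocity ?\<gamma> t) (velocity ?\<gamma> t))) *\<^sub>R ?\<gamma> t c p
       + (\<Phi> (w t) / 4 * g02 (?\<gamma> t) (velocity ?\<gamma> t) (velocity ?\<gamma> t) c p) *\<^sub>R ?\<gamma> t c p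
       + \<Phi> (w t) *\<^sub>R (velocity ?\<gamma> t c p ** matrix_inv (?\<gamma> t c p) ** velocity ?\<gamma> t c p)
       - (\<Phi> (w t) / 2 * g02 (?\<gamma> t) (velocity ?\<gamma> t) (?\<gamma> t) c p) *\<^sub>R velocity ?\<gamma> t c p) (at t))
     \<longleftrightarrow> K t = L t" (is "?eqs \<longleftrightarrow> _") if t: "t \<in> I" for t
  proof
    assume eqs: ?eqs
    have "((\<lambda>s. \<Phi> (w s) *\<^sub>R velocity ?\<gamma> s c\<^sub>0 p\<^sub>0) has_vector_derivative L t *\<^sub>R g c\<^sub>0 p\<^sub>0) (at t)"
      using bspec[OF bspec[OF eqs cp(1)] cp(2)] unfolding rhs[OF t cp] .
    from vector_derivative_unique_at[OF lhs[OF t] this]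
    show "K t = L t" using metric_nonzero[OF g cp] by simp
  next
    assume "K t = L t"
    then show ?eqs
      using lhs[OF t] by (intro ballI) (simp only: rhs[OF t])
  qed
  have ode: "K t = L t \<longleftrightarrow> deriv (deriv r) t * \<Phi> (w t) =
       (deriv r t)\<^sup>2 / r t * (- ?n / 4 * deriv \<Phi> (w t) * w t + (1 - ?n / 4) * \<Phi> (w t))" if t: "t \<in> I" for t
  proof -
    have "L t - (K t - \<Phi> (w t) * deriv (deriv r) t) =
      (deriv r t)\<^sup>2 / r t * (- ?n / 4 * deriv \<Phi> (w t) * w t + (1 - ?n / 4) * \<Phi> (w t))"
      using r_pos[OF t] unfolding K_def L_def by (simp add: field_simps power2_eq_square)
    then show ?thesis by (auto simp: mult.commute)
  qed
  have "geodesic_on X A \<Phi> I ?\<gamma> \<longleftrightarrow> (\<forall>t\<in>I. K t = L t)"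
    unfolding geodesic_on_def Let_def w_def[symmetric]
    using smooth_path_tscale[OF metric_tensor[OF g] I r] metric pointwise by simp
  then show ?thesis
    unfolding Let_def w_def[symmetric] using ode by simp
qed

end

section \<open>Incompleteness\<close>

text \<open>The solution is the inverse of a primitive \<open>H\<close> of \<open>F\<close>, defined on the
  range of \<open>H\<close>. Since \<open>H - (C / \<beta>) e\<^bsup>\<beta>x\<^esup>\<close> is nonincreasing
  below \<open>x\<^sub>1\<close>, \<open>H\<close> is bounded below, and the solution falls below every
  \<open>y\<close> on approaching the infimum \<open>a\<close> of that range.\<close>

lemma ode_escape:
  fixes F :: "real \<Rightarrow> real"
  assumes F: "smooth_on UNIV F" and F_pos: "\<And>x. 0 < F x"
    and bound: "\<And>x. x \<le> x\<^sub>1 \<Longrightarrow> F x \<le> C * exp (\<beta> * x)" and \<beta>: "0 < \<beta>"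
  obtains x J a where "open_interval J" "smooth_on J x"
    "\<And>t. t \<in> J \<Longrightarrow> (x has_real_derivative inverse (F (x t))) (at t)"
    "\<And>y. \<exists>b>a. \<forall>t\<in>{a<..<b}. t \<in> J \<and> x t < y"
proof -
  have FC: "C_on k UNIV F" for k using F by (simp add: smooth_on_def)
  have F_cont: "isCont F x" for x
    using FC[of 0] by (simp add: continuous_on_eq_continuous_at)
  obtain H where "\<forall>x :: real. - \<infinity> < ereal x \<longrightarrow> ereal x < \<infinity> \<longrightarrow> (H has_vector_derivative F x) (at x)"
    using einterval_antiderivative[of "- \<infinity>" \<infinity> F] F_cont by auto
  then have dH: "(H has_real_derivative F x) (at x)" for x
    by (simp add: has_real_derivative_iff_has_vector_derivative)
  have H_cont: "isCont H x" for x by (rule DERIV_isCont[OF dH])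
  have H_less: "H x < H y" if "x < y" for x y
    by (rule DERIV_pos_imp_increasing[OF that]) (use dH F_pos in blast)
  then have H_mono: "strict_mono H" by (rule strict_monoI)
  have H_less_iff: "H x < H y \<longleftrightarrow> x < y" for x y by (rule strict_mono_less[OF H_mono])
  define J where "J = range H"
  have J_open: "open J"
    unfolding J_def by (rule invariance_of_domain)
      (auto intro: continuous_at_imp_continuous_on H_cont strict_mono_imp_inj_on[OF H_mono])
  have J_int: "is_interval J"
    unfolding J_def is_interval_connected_1
    by (intro connected_continuous_image continuous_at_imp_continuous_on ballI H_cont connected_UNIV)
  \<comment> \<open>the lower bound that the monotone difference gives for \<open>H\<close>\<close>
  define m where "m = H x\<^sub>1 - C / \<beta> * exp (\<beta> * x\<^sub>1)"
  have C_pos: "0 < C"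
    using bound[of x\<^sub>1] F_pos[of x\<^sub>1] by (smt (verit) exp_gt_zero mult_nonpos_nonneg)
  have low: "m \<le> H x" if "x \<le> x\<^sub>1" for x
  proof -
    let ?D = "\<lambda>x. H x - C / \<beta> * exp (\<beta> * x)"
    have "?D x\<^sub>1 \<le> ?D x"
    proof (rule DERIV_nonpos_imp_nonincreasing[OF that])
      fix y assume "x \<le> y" "y \<le> x\<^sub>1"
      moreover have "(?D has_real_derivative F y - C * exp (\<beta> * y)) (at y)"
        using \<beta> by (auto intro!: derivative_eq_intros dH)
      ultimately show "\<exists>z. (?D has_real_derivative z) (at y) \<and> z \<le> 0"
        using bound[of y] by (intro exI[of _ "F y - C * exp (\<beta> * y)"]) simp
    qed
    moreover have "0 \<le> C / \<beta> * exp (\<beta> * x)" using C_pos \<beta> by simp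
    ultimately show ?thesis by (simp add: m_def)
  qed
  have J_bdd: "bdd_below J"
  proof (rule bdd_belowI)
    fix t assume "t \<in> J"
    then obtain x where x: "t = H x" unfolding J_def by blast
    show "m \<le> t"
    proof (cases "x \<le> x\<^sub>1")
      case False
      then have "H x\<^sub>1 < H x" by (intro H_less) simp
      then show ?thesis using low[of x\<^sub>1] x by simp
    qed (use low x in simp)
  qed
  define a where "a = Inf J"
  have a_lt: "a < t" if "t \<in> J" for t
  proof -
    obtain e where e: "0 < e" "ball t e \<subseteq> J" using J_open \<open>t \<in> J\<close> open_contains_ball by blast
    have "t - e / 2 \<in> J" using e by (intro subsetD[OF e(2)]) (simp add: dist_real_def)
    then have "a \<le> t - e / 2" unfolding a_def by (rule cInf_lower[OF _ J_bdd])
    then show ?thesis using e(1) by simp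
  qed
  define x where "x = inv H"
  have xH: "x (H y) = y" for y
    unfolding x_def by (rule inv_f_f[OF strict_mono_imp_inj_on[OF H_mono]])
  have Hx: "H (x t) = t" if "t \<in> J" for t
    using that xH by (auto simp: J_def)
  have x_cont: "isCont x t" if "t \<in> J" for t
    using isCont_inverse_function[of 1 "x t" x H] by (simp add: xH H_cont Hx that)
  have dx: "(x has_real_derivative inverse (F (x t))) (at t)" if t: "t \<in> J" for t
  proof -
    obtain e where e: "0 < e" "ball t e \<subseteq> J" using J_open t open_contains_ball by blast
    show ?thesis
    proof (rule DERIV_inverse_function[OF dH _ _ _ _ x_cont[OF t]])
      show "F (x t) \<noteq> 0" using F_pos[of "x t"] by simp
      show "t - e < t" "t < t + e" using e(1) by simp_all
      show "H (x s) = s" if "t - e < s" "s < t + e" for s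
        by (intro Hx subsetD[OF e(2)]) (use that in \<open>simp add: dist_real_def abs_if\<close>)
    qed
  qed
  have x_smooth: "C_on k J x" for k
  proof (induction k)
    case 0
    show ?case by (simp add: continuous_at_imp_continuous_on x_cont)
  next
    case (Suc k)
    have "C_on k J (\<lambda>t. inverse (F (x t)))"
    proof (rule C_on_compose[OF J_open _ open_greaterThan _ C_on_inverse])
      show "C_on k J (\<lambda>t. F (x t))"
        by (rule C_on_compose[OF J_open subset_UNIV open_UNIV Suc FC])
    qed (use F_pos in auto)
    then show ?case by (intro C_on_realI[OF J_open dx])
  qed
  show ?thesis
  proof (rule that[of J x a])
    show "open_interval J"
      using J_open J_int by (simp add: open_interval_def J_def)
    show "smooth_on J x" using x_smooth by (simp add: smooth_on_def)
    fix y
    have "t \<in> J \<and> x t < y" if t: "t \<in> {a<..<H y}" for t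
    proof -
      have Hy: "H y \<in> J" by (simp add: J_def)
      have "Inf J < t" using t by (simp add: a_def)
      then obtain s where "s \<in> J" "s < t"
        using cInf_less_iff[of J t] J_bdd Hy by blast
      then have "t \<in> J"
        using J_int Hy t unfolding is_interval_1 by (meson greaterThanLessThan_iff less_imp_le)
      moreover have "H (x t) < H y" using Hx[OF \<open>t \<in> J\<close>] t by simp
      ultimately show ?thesis using H_less_iff by simp
    qed
    then show "\<exists>b>a. \<forall>t\<in>{a<..<b}. t \<in> J \<and> x t < y"
      using a_lt[of "H y"] by (intro exI[of _ "H y"]) (simp add: J_def)
  qed (rule dx)
qed

context manifold
begin

text \<open>With \<open>S = 2 ln F\<close> the solution \<open>r = e\<^bsup>x\<^esup>\<close> satisfies
  \<open>r' = r e\<^bsup>-S(x)/2\<^esup>\<close> and \<open>r'' = r e\<^bsup>-S(x)\<^esup> (1 -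
  S'(x)/2)\<close>; the geodesic equation is then the formula for \<open>S'\<close>. Working with
  \<open>S\<close> and \<open>x\<close> rather than with \<open>F\<close> and \<open>r\<close> makes all
  functions smooth on the whole line.\<close>

lemma incomplete_if_bigo:
  assumes ne: "topspace X \<noteq> {}"
    and \<Phi>: "smooth_on {0<..} \<Phi>" and \<Phi>_pos: "\<And>s. 0 < s \<Longrightarrow> 0 < \<Phi> s"
    and k: "-1 < k" and O: "\<Phi> \<in> O[at_right 0](\<lambda>s. s powr k)"
  shows "geodesically_incomplete X A \<Phi>"
proof -
  obtain g where g: "g \<in> metrics X A" using ex_in_conv[THEN iffD2, OF metric_exists] ..
  define V where "V = Vol X A g"
  define n where "n = real CARD('n)"
  define S where "S x = ln (\<Phi> (V * exp (n / 2 * x))) + n / 2 * x" for x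
  define F where "F x = exp (1 / 2 * S x)" for x
  have V: "0 < V" unfolding V_def by (rule Vol_pos[OF g ne])
  have n: "0 < n" by (simp add: n_def)
  have \<Phi>C: "C_on i {0<..} \<Phi>" for i using \<Phi> by (simp add: smooth_on_def)
  have lin: "C_on i UNIV ((*) (c :: real))" for c i
    by (rule C_on_linear[OF open_UNIV bounded_linear_mult_right])
  have v_smooth: "C_on i UNIV (\<lambda>x. V * exp (n / 2 * x))" for i
    by (intro C_on_bilinear[OF open_UNIV bounded_bilinear_mult] C_on_const
        C_on_compose[OF open_UNIV subset_UNIV open_UNIV lin C_on_exp])
  have "range (\<lambda>x. V * exp (n / 2 * x)) \<subseteq> {0<..}" by (intro image_subsetI) (simp add: V)
  note \<Phi>v_smooth = C_on_compose[OF open_UNIV this open_greaterThan v_smooth \<Phi>C]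
  have "range (\<lambda>x. \<Phi> (V * exp (n / 2 * x))) \<subseteq> {0<..}" by (intro image_subsetI) (simp add: V \<Phi>_pos)
  note ln_smooth = C_on_compose[OF open_UNIV this open_greaterThan \<Phi>v_smooth C_on_ln]
  have S_smooth: "C_on i UNIV S" for i
    unfolding S_def by (intro C_on_add[OF open_UNIV] ln_smooth lin)
  have "C_on i UNIV F" for i
    unfolding F_def
    by (rule C_on_compose[OF open_UNIV subset_UNIV open_UNIV
          C_on_compose[OF open_UNIV subset_UNIV open_UNIV S_smooth lin] C_on_exp])
  then have F_smooth: "smooth_on UNIV F" by (simp add: smooth_on_def)
  obtain C where "0 < C" and ev: "\<forall>\<^sub>F s in at_right 0. norm (\<Phi> s) \<le> C * norm (s powr k)"
    using O by (rule landau_o.bigE)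
  then obtain s\<^sub>0 where s0: "0 < s\<^sub>0" "\<forall>s>0. s < s\<^sub>0 \<longrightarrow> norm (\<Phi> s) \<le> C * norm (s powr k)"
    unfolding eventually_at_right_field by (elim exE conjE)
  \<comment> \<open>for \<open>x \<le> x\<^sub>1\<close> the volume \<open>V * exp (n / 2 * x)\<close> is at most \<open>s\<^sub>0 / 2\<close>, where the bound on \<open>\<Phi>\<close> holds\<close>
  define x\<^sub>1 where "x\<^sub>1 = 2 / n * ln (s\<^sub>0 / (2 * V))"
  define \<beta> where "\<beta> = (k + 1) * n / 4"
  have bound: "F x \<le> exp ((ln C + k * ln V) / 2) * exp (\<beta> * x)" if x: "x \<le> x\<^sub>1" for x
  proof -
    let ?s = "V * exp (n / 2 * x)"
    have s: "0 < ?s" using V by simp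
    have "n / 2 * x \<le> ln (s\<^sub>0 / (2 * V))"
      using x n by (simp add: x\<^sub>1_def field_simps)
    then have "exp (n / 2 * x) \<le> s\<^sub>0 / (2 * V)"
      using V s0(1) by (subst ln_ge_iff[symmetric]) simp_all
    then have "?s < s\<^sub>0" using V s0(1) by (simp add: field_simps)
    then have "ln (\<Phi> ?s) \<le> ln (C * ?s powr k)"
      using s0(2)[rule_format, OF s] \<Phi>_pos[OF s] \<open>0 < C\<close> s by simp
    also have "\<dots> = ln C + k * (ln V + n / 2 * x)"
      using \<open>0 < C\<close> V by (simp add: ln_mult ln_powr)
    finally have "1 / 2 * S x \<le> (ln C + k * ln V) / 2 + \<beta> * x"
      by (simp add: S_def \<beta>_def field_simps)
    then show ?thesis by (simp add: F_def flip: exp_add)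
  qed
  have \<beta>: "0 < \<beta>" using k n by (simp add: \<beta>_def)
  have F_pos: "0 < F x" for x by (simp add: F_def)
  obtain x J a where J: "open_interval J" and x: "smooth_on J x"
    and dx: "\<And>t. t \<in> J \<Longrightarrow> (x has_real_derivative inverse (F (x t))) (at t)"
    and escape: "\<And>y. \<exists>b>a. \<forall>t\<in>{a<..<b}. t \<in> J \<and> x t < y"
    by (rule ode_escape[of F x\<^sub>1 "exp ((ln C + k * ln V) / 2)" \<beta>, OF F_smooth F_pos bound \<beta>])
       (assumption, rule that)
  have J_open: "open J" using J by (simp add: open_interval_def)
  define r where "r t = exp (x t)" for t
  have r_pos: "0 < r t" for t by (simp add: r_def)
  have r_smooth: "smooth_on J r"
    unfolding r_def smooth_on_def
    by (intro allI C_on_compose[OF J_open subset_UNIV open_UNIV _ C_on_exp])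
       (use x in \<open>simp add: smooth_on_def\<close>)
  have dS: "(S has_real_derivative
      deriv \<Phi> (V * exp (n / 2 * y)) * (V * exp (n / 2 * y) * (n / 2)) / \<Phi> (V * exp (n / 2 * y)) + n / 2) (at y)" for y
  proof -
    let ?v = "\<lambda>x. V * exp (n / 2 * x)"
    have pos: "0 < ?v y" using V by simp
    have "(?v has_real_derivative ?v y * (n / 2)) (at y)"
      by (auto intro!: derivative_eq_intros)
    from DERIV_chain2[OF C_on_realD(1)[OF open_greaterThan \<Phi>C, of "?v y"] this]
    have "((\<lambda>x. \<Phi> (?v x)) has_real_derivative deriv \<Phi> (?v y) * (?v y * (n / 2))) (at y)"
      using pos by simp
    from DERIV_chain2[OF DERIV_ln_divide[OF \<Phi>_pos[OF pos]] this]
    have "((\<lambda>x. ln (\<Phi> (?v x))) has_real_derivative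
        deriv \<Phi> (?v y) * (?v y * (n / 2)) / \<Phi> (?v y)) (at y)"
      by (rule DERIV_cong) simp
    then show ?thesis
      unfolding S_def by (rule DERIV_add) (auto intro!: derivative_eq_intros)
  qed
  have dx': "(x has_real_derivative exp (- (1 / 2) * S (x t))) (at t)" if "t \<in> J" for t
    using dx[OF that] by (simp add: F_def exp_minus)
  have dr: "deriv r t = r t * exp (- (1 / 2) * S (x t))" if "t \<in> J" for t
    unfolding r_def by (rule DERIV_imp_deriv) (auto intro!: derivative_eq_intros dx' that)
  have ddr: "deriv (deriv r) t = r t * exp (- S (x t)) * (1 - deriv S (x t) / 2)" if t: "t \<in> J" for t
  proof (rule DERIV_imp_deriv)
    have "exp (- (1 / 2) * S (x t)) * exp (- (1 / 2) * S (x t)) = exp (- S (x t))"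
      by (simp flip: exp_add)
    moreover have "((\<lambda>t. S (x t)) has_real_derivative deriv S (x t) * exp (- (1 / 2) * S (x t))) (at t)"
      by (rule DERIV_chain2[OF C_on_realD(1)[OF open_UNIV S_smooth UNIV_I] dx'[OF t]])
    then have "((\<lambda>t. r t * exp (- (1 / 2) * S (x t))) has_real_derivative
        r t * (exp (- (1 / 2) * S (x t)) * exp (- (1 / 2) * S (x t))) * (1 - deriv S (x t) / 2)) (at t)"
      unfolding r_def by (auto intro!: derivative_eq_intros dx'[OF t] simp: algebra_simps)
    ultimately have "((\<lambda>t. r t * exp (- (1 / 2) * S (x t))) has_real_derivative
        r t * exp (- S (x t)) * (1 - deriv S (x t) / 2)) (at t)" by (simp only:)
    then show "(deriv r has_real_derivative r t * exp (- S (x t)) * (1 - deriv S (x t) / 2)) (at t)"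
      by (rule has_field_derivative_transform_within_open[OF _ J_open t]) (simp add: dr)
  qed
  have "geodesic_on X A \<Phi> J (\<lambda>t. tscale (r t) g)"
    unfolding geodesic_ray_iff[OF g ne \<Phi> J_open r_smooth r_pos] Let_def n_def[symmetric]
  proof (intro ballI)
    fix t assume t: "t \<in> J"
    let ?v = "V * exp (n / 2 * x t)"
    have v: "Vol X A (tscale (r t) g) = ?v"
      using Vol_tscale[OF r_pos, of t g] by (simp add: r_def V_def n_def powr_def mult.commute)
    have "0 < \<Phi> ?v" using V by (intro \<Phi>_pos) simp
    then have S': "deriv S (x t) * \<Phi> ?v = n / 2 * (deriv \<Phi> ?v * ?v + \<Phi> ?v)"
      unfolding DERIV_imp_deriv[OF dS] by (simp add: field_simps)
    have r': "(deriv r t)\<^sup>2 / r t = r t * exp (- S (x t))"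
      using r_pos[of t] by (simp add: dr[OF t] power2_eq_square flip: exp_add)
    have "r t * exp (- S (x t)) * (1 - deriv S (x t) / 2) * \<Phi> ?v
        = r t * exp (- S (x t)) * (\<Phi> ?v - deriv S (x t) * \<Phi> ?v / 2)"
      by (simp add: algebra_simps)
    also have "\<dots> = r t * exp (- S (x t)) * (- n / 4 * deriv \<Phi> ?v * ?v + (1 - n / 4) * \<Phi> ?v)"
      unfolding S' by (simp add: algebra_simps)
    finally show "deriv (deriv r) t * \<Phi> (Vol X A (tscale (r t) g)) = (deriv r t)\<^sup>2 / r t *
        (- n / 4 * deriv \<Phi> (Vol X A (tscale (r t) g)) * Vol X A (tscale (r t) g)
          + (1 - n / 4) * \<Phi> (Vol X A (tscale (r t) g)))"
      unfolding v ddr[OF t] r' .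
  qed
  moreover have "\<not> (\<exists>\<delta>. geodesic_on X A \<Phi> UNIV \<delta> \<and> (\<forall>t\<in>J. \<delta> t = tscale (r t) g))"
  proof (intro notI, elim exE conjE)
    fix \<delta> assume \<delta>: "geodesic_on X A \<Phi> UNIV \<delta>" "\<forall>t\<in>J. \<delta> t = tscale (r t) g"
    have path: "smooth_path_on X A UNIV \<delta>" and "\<forall>t\<in>UNIV. \<delta> t \<in> metrics X A"
      using \<delta>(1) unfolding geodesic_on_def by - (elim conjE, assumption)+
    then have metric: "\<delta> a \<in> metrics X A" by simp
    obtain c p where cp: "c \<in> A" "p \<in> fst c" using point_exists[OF ne] .
    have "((\<lambda>t. \<delta> t c p) \<longlongrightarrow> \<delta> a c p) (at a)"
      using smooth_path_continuous[OF path, of c p] by (simp add: continuous_on_def)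
    then have "((\<lambda>t. \<delta> t c p) \<longlongrightarrow> \<delta> a c p) (at_right a)"
      by (rule tendsto_within_subset) (rule subset_UNIV)
    moreover have "((\<lambda>t. \<delta> t c p) \<longlongrightarrow> 0) (at_right a)"
    proof (rule Lim_transform_eventually)
      have "(r \<longlongrightarrow> 0) (at_right a)"
      proof (rule tendstoI)
        fix e :: real assume e: "0 < e"
        obtain b where b: "a < b" "\<forall>t\<in>{a<..<b}. t \<in> J \<and> x t < ln e"
          using escape[of "ln e"] by (elim exE conjE)
        have "dist (r t) 0 < e" if "a < t" "t < b" for t
        proof -
          have "exp (x t) < exp (ln e)" using b(2) that by (intro exp_less_mono) simp
          then show ?thesis using e by (simp add: r_def)
        qed
        then show "\<forall>\<^sub>F t in at_right a. dist (r t) 0 < e"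
          unfolding eventually_at_right_field using b(1) by (intro exI[of _ b]) simp
      qed
      then show "((\<lambda>t. r t *\<^sub>R g c p) \<longlongrightarrow> 0) (at_right a)"
        using tendsto_scaleR[OF _ tendsto_const, of r 0 "at_right a" "g c p"] by simp
      obtain b where "a < b" "\<forall>t\<in>{a<..<b}. t \<in> J \<and> x t < 0"
        using escape[of 0] by (elim exE conjE)
      then show "\<forall>\<^sub>F t in at_right a. r t *\<^sub>R g c p = \<delta> t c p"
        unfolding eventually_at_right_field using \<delta>(2)
        by (intro exI[of _ b]) (simp add: tscale_def)
    qed
    ultimately have "\<delta> a c p = 0"
      by (rule tendsto_unique[OF trivial_limit_at_right_real])
    then show False using metric_nonzero[OF metric cp] by simp
  qed
  ultimately show ?thesis
    unfolding geodesically_incomplete_def using J by (intro exI conjI)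
qed

end

section \<open>The theorem\<close>

theorem mainTheorem7:
  fixes X :: "'a topology" and A :: "('a, 'n::finite) chart set" and \<Phi> :: "real \<Rightarrow> real"
  assumes "compact_smooth_manifold X A" and "topspace X \<noteq> {}"
    and "smooth_on {0<..} \<Phi>" and "\<And>s. 0 < s \<Longrightarrow> 0 < \<Phi> s"
  shows "(\<forall>g\<^sub>0 \<in> metrics X A.
            submanifold X A (ray g\<^sub>0) \<and> totally_geodesic X A \<Phi> (ray g\<^sub>0) \<and>
            (\<forall>I r. open_interval I \<and> smooth_on I r \<and> (\<forall>t\<in>I. 0 < r t) \<longrightarrow>
               (geodesic_on X A \<Phi> I (\<lambda>t. tscale (r t) g\<^sub>0) \<longleftrightarrow>
                (\<forall>t\<in>I. let v = Vol X A (tscale (r t) g\<^sub>0); n = real CARD('n) in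
                   deriv (deriv r) t * \<Phi> v =
                   (deriv r t)\<^sup>2 / r t * (- n / 4 * deriv \<Phi> v * v + (1 - n / 4) * \<Phi> v)))))
       \<and> ((\<exists>k>-1. \<Phi> \<in> O[at_right 0](\<lambda>s. s powr k)) \<longrightarrow> geodesically_incomplete X A \<Phi>)"
proof -
  interpret manifold X A
    by (rule manifold.intro) (rule assms(1))
  show ?thesis
  proof (intro conjI ballI allI impI)
    fix g assume g: "g \<in> metrics X A"
    show "submanifold X A (ray g)" by (rule submanifold_ray[OF g assms(2)])
    show "totally_geodesic X A \<Phi> (ray g)" by (rule totally_geodesic_ray[OF g assms(2)])
    fix I and r :: "real \<Rightarrow> real" assume I: "open_interval I \<and> smooth_on I r \<and> (\<forall>t\<in>I. 0 < r t)"
    show "geodesic_on X A \<Phi> I (\<lambda>t. tscale (r t) g) \<longleftrightarrow>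
        (\<forall>t\<in>I. let v = Vol X A (tscale (r t) g); n = real CARD('n) in
           deriv (deriv r) t * \<Phi> v =
           (deriv r t)\<^sup>2 / r t * (- n / 4 * deriv \<Phi> v * v + (1 - n / 4) * \<Phi> v))"
    proof (rule geodesic_ray_iff[OF g assms(2,3)])
      show "open I" using I unfolding open_interval_def by (elim conjE)
      show "smooth_on I r" using I by (elim conjE)
      show "0 < r t" if "t \<in> I" for t using I that by (elim conjE) (rule bspec)
    qed
  next
    assume "\<exists>k>-1. \<Phi> \<in> O[at_right 0](\<lambda>s. s powr k)"
    then obtain k where k: "- 1 < k" "\<Phi> \<in> O[at_right 0](\<lambda>s. s powr k)" by (elim exE conjE)
    show "geodesically_incomplete X A \<Phi>"
      by (rule incomplete_if_bigo[OF assms(2,3) _ k]) (rule assms(4))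
  qed
qed

end
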